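(* Let $M$ be a $C^\infty$ Riemannian manifold of dimension $n\ge 2$, let $u$ be a smooth function on a domain $\Omega\subset M$ whose gradient never vanishes, and let $\Sigma=\mathrm{graph}(u)\subset M\times\mathbb{R}$. If the angle function of $\Sigma$ is nonconstant, then the following are equivalent: (i) $\Sigma$ is a vertical helicoid in $M\times\mathbb{R}$; (ii) $u$ is harmonic and $\Sigma$ is minimal; (iii) $u$ is harmonic and horizontally homothetic.
   Context: $M\times\mathbb{R}$ carries the product metric $\langle\,,\rangle=\langle\,,\rangle_M+dt^2$ with Levi-Civita connection $\overline\nabla$; $\partial_t$ is the unit vertical field. For an orientable hypersurface $\Sigma\subset M\times\mathbb{R}$ with unit normal $N$: the shape operator is $AX=-\overline\nabla_XN$; $\xi$ is the restriction to $\Sigma$ of the projection onto $\mathbb{R}$ (height function), with gradient $\nabla\xi$ on $\Sigma$; $\Theta=\langle N,\partial_t\rangle$ is the angle function. A horizontal point is a critical point of $\xi$, i.e. a point where $\Theta^2=1$. A horizontal section of $\Sigma$ is $\Sigma_t=\Sigma\cap(M\times\{t\})$ when the intersection is transversal. Vertical helicoid: a hypersurface with no horizontal points and nonconstant angle function whose horizontal sections $\Sigma_t$ are minimal hypersurfaces of $M\times\{t\}$ and such that $\langle A\nabla\xi,\nabla\xi\rangle=0$ on $\Sigma$. A smooth function $u$ on $\Omega\subset M$ is horizontally homothetic if $\langle\nabla u,\nabla\|\nabla u\|\rangle=0$ on $\Omega$. *)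

theory Defs
  imports "HOL-Analysis.Analysis"
begin

section \<open>Smooth maps between Euclidean spaces\<close>

text \<open>Both notions are meant for open sets \<open>S\<close>.\<close>

primrec C_k_on :: "nat \<Rightarrow> 'a::euclidean_space set \<Rightarrow> ('a \<Rightarrow> 'b::real_normed_vector) \<Rightarrow> bool" where
  "C_k_on 0 S f \<longleftrightarrow> continuous_on S f"
| "C_k_on (Suc k) S f \<longleftrightarrow>
     f differentiable_on S \<and> (\<forall>v. C_k_on k S (\<lambda>x. frechet_derivative f (at x) v))"

definition smooth_on :: "'a::euclidean_space set \<Rightarrow> ('a \<Rightarrow> 'b::real_normed_vector) \<Rightarrow> bool" where
  "smooth_on S f \<longleftrightarrow> (\<forall>k. C_k_on k S f)"


section \<open>Riemannian manifolds\<close>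

text \<open>
  A Riemannian manifold is given by an atlas. Each chart carries, besides its domain and its
  coordinate map into the model space \<open>'a\<close>, the coordinate expression of the metric tensor:
  \<open>metric_tensor c x v w\<close> is the inner product of the vectors with components \<open>v\<close>, \<open>w\<close>
  at the point with coordinates \<open>x\<close>. The dimension is \<open>DIM('a)\<close>. The atlas need not be maximal.
\<close>

record ('m, 'a) rchart =
  chart_dom :: "'m set"
  coord :: "'m \<Rightarrow> 'a"
  metric_tensor :: "'a \<Rightarrow> 'a \<Rightarrow> 'a \<Rightarrow> real"

definition carrier_of :: "('m, 'a) rchart set \<Rightarrow> 'm set" where
  "carrier_of M = (\<Union>c\<in>M. chart_dom c)"

definition local_rep :: "('m, 'a) rchart \<Rightarrow> ('m \<Rightarrow> 'b) \<Rightarrow> 'a \<Rightarrow> 'b" where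
  "local_rep c f = (\<lambda>x. f (inv_into (chart_dom c) (coord c) x))"

text \<open>The Jacobian at \<open>p\<close> of the change of coordinates from \<open>c\<close> to \<open>d\<close>.\<close>

definition transition_deriv ::
    "('m, 'a::euclidean_space) rchart \<Rightarrow> ('m, 'a) rchart \<Rightarrow> 'm \<Rightarrow> 'a \<Rightarrow> 'a" where
  "transition_deriv c d p = frechet_derivative (local_rep c (coord d)) (at (coord c p))"

definition smooth_atlas ::
    "('m::{t2_space,second_countable_topology}, 'a::euclidean_space) rchart set \<Rightarrow> bool" where
  "smooth_atlas M \<longleftrightarrow>
     (\<forall>c\<in>M. open (chart_dom c) \<and> open (coord c ` chart_dom c) \<and>
        homeomorphism (chart_dom c) (coord c ` chart_dom c)
          (coord c) (inv_into (chart_dom c) (coord c))) \<and>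
     (\<forall>c\<in>M. \<forall>d\<in>M. smooth_on (coord c ` (chart_dom c \<inter> chart_dom d)) (local_rep c (coord d)))"

definition rinner :: "('m, 'a) rchart \<Rightarrow> 'm \<Rightarrow> 'a \<Rightarrow> 'a \<Rightarrow> real" where
  "rinner c p v w = metric_tensor c (coord c p) v w"

definition rnorm :: "('m, 'a) rchart \<Rightarrow> 'm \<Rightarrow> 'a \<Rightarrow> real" where
  "rnorm c p v = sqrt (rinner c p v v)"

definition riemannian_manifold ::
    "('m::{t2_space,second_countable_topology}, 'a::euclidean_space) rchart set \<Rightarrow> bool" where
  "riemannian_manifold M \<longleftrightarrow>
     smooth_atlas M \<and>
     (\<forall>c\<in>M. \<forall>v w. smooth_on (coord c ` chart_dom c) (\<lambda>x. metric_tensor c x v w)) \<and>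
     (\<forall>c\<in>M. \<forall>p\<in>chart_dom c. bilinear (rinner c p) \<and>
        (\<forall>v w. rinner c p v w = rinner c p w v) \<and> (\<forall>v. v \<noteq> 0 \<longrightarrow> rinner c p v v > 0)) \<and>
     (\<forall>c\<in>M. \<forall>d\<in>M. \<forall>p\<in>chart_dom c \<inter> chart_dom d. \<forall>v w.
        rinner d p (transition_deriv c d p v) (transition_deriv c d p w) = rinner c p v w)"

definition smooth_fun_on ::
    "('m, 'a::euclidean_space) rchart set \<Rightarrow> 'm set \<Rightarrow> ('m \<Rightarrow> real) \<Rightarrow> bool" where
  "smooth_fun_on M U f \<longleftrightarrow> (\<forall>c\<in>M. smooth_on (coord c ` (U \<inter> chart_dom c)) (local_rep c f))"

text \<open>
  In the chart \<open>c\<close> the Levi-Civita connection is \<open>D + G\<close>, where \<open>D\<close> is the flat derivative and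
  the Christoffel tensor \<open>G\<close> is determined by torsion-freeness (symmetry of \<open>G\<close>) and
  compatibility with the metric.
\<close>

definition levi_civita :: "('m, 'a::euclidean_space) rchart \<Rightarrow> 'm \<Rightarrow> 'a \<Rightarrow> 'a \<Rightarrow> 'a" where
  "levi_civita c p = (THE G. bilinear G \<and> (\<forall>v w. G v w = G w v) \<and>
     (\<forall>z v w. frechet_derivative (\<lambda>x. metric_tensor c x v w) (at (coord c p)) z =
        rinner c p (G z v) w + rinner c p v (G z w)))"

text \<open>
  The Riemannian product of \<open>M\<close> with the real line. In its charts the vertical unit field
  has components \<open>(0, 1)\<close>.
\<close>

definition prod_line_chart :: "('m, 'a) rchart \<Rightarrow> ('m \<times> real, 'a \<times> real) rchart" where
  "prod_line_chart c =
     \<lparr> chart_dom = chart_dom c \<times> UNIV,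
       coord = (\<lambda>(p, t). (coord c p, t)),
       metric_tensor = (\<lambda>(x, t) (v, a) (w, b). metric_tensor c x v w + a * b) \<rparr>"

definition prod_line :: "('m, 'a) rchart set \<Rightarrow> ('m \<times> real, 'a \<times> real) rchart set" where
  "prod_line M = prod_line_chart ` M"


section \<open>Submanifolds\<close>

text \<open>
  The definitions taking a set \<open>S\<close> of points are used for open subsets and for embedded
  hypersurfaces. Tangent vectors are represented by their components in the chart \<open>c\<close>.
\<close>

definition tangent_space ::
    "('m, 'a::euclidean_space) rchart \<Rightarrow> 'm set \<Rightarrow> 'm \<Rightarrow> 'a set" where
  "tangent_space c S p = {v. \<exists>\<gamma> e. e > 0 \<and> smooth_on {-e<..<e} \<gamma> \<and>
     \<gamma> ` {-e<..<e} \<subseteq> coord c ` (S \<inter> chart_dom c) \<and>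
     \<gamma> 0 = coord c p \<and> (\<gamma> has_vector_derivative v) (at (0::real))}"

text \<open>
  The derivative at \<open>p\<close> of a function given on \<open>S\<close>. Only its values on
  \<open>tangent_space c S p\<close> are determined, and only these are used below.
\<close>

definition deriv_along :: "('m, 'a::euclidean_space) rchart \<Rightarrow> 'm set \<Rightarrow>
    ('m \<Rightarrow> 'b::real_normed_vector) \<Rightarrow> 'm \<Rightarrow> 'a \<Rightarrow> 'b" where
  "deriv_along c S f p =
     frechet_derivative (local_rep c f) (at (coord c p) within coord c ` (S \<inter> chart_dom c))"

definition grad :: "('m, 'a::euclidean_space) rchart \<Rightarrow> 'm set \<Rightarrow> ('m \<Rightarrow> real) \<Rightarrow> 'm \<Rightarrow> 'a" where
  "grad c S f p = (THE v. v \<in> tangent_space c S p \<and>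
     (\<forall>w\<in>tangent_space c S p. rinner c p v w = deriv_along c S f p w))"

text \<open>
  A field \<open>Y\<close> of vectors of the ambient manifold along \<open>S\<close> is represented by its components
  \<open>Y c p\<close> in each chart; smoothness along \<open>S\<close> means local smooth extendability.
\<close>

definition smooth_field_along :: "('m, 'a::euclidean_space) rchart set \<Rightarrow> 'm set \<Rightarrow>
    (('m, 'a) rchart \<Rightarrow> 'm \<Rightarrow> 'a) \<Rightarrow> bool" where
  "smooth_field_along M S Y \<longleftrightarrow>
     (\<forall>c\<in>M. \<forall>d\<in>M. \<forall>p\<in>S \<inter> chart_dom c \<inter> chart_dom d. Y d p = transition_deriv c d p (Y c p)) \<and>
     (\<forall>c\<in>M. \<forall>p\<in>S \<inter> chart_dom c. \<exists>V F. open V \<and> coord c p \<in> V \<and> smooth_on V F \<and>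
        (\<forall>q\<in>S \<inter> chart_dom c. coord c q \<in> V \<longrightarrow> F (coord c q) = Y c q))"

definition cov_deriv :: "('m, 'a::euclidean_space) rchart \<Rightarrow> 'm set \<Rightarrow>
    (('m, 'a) rchart \<Rightarrow> 'm \<Rightarrow> 'a) \<Rightarrow> 'm \<Rightarrow> 'a \<Rightarrow> 'a" where
  "cov_deriv c S Y p v = deriv_along c S (Y c) p v + levi_civita c p v (Y c p)"

text \<open>The trace of an endomorphism \<open>L\<close> of the subspace \<open>T\<close>.\<close>

definition trace_on :: "'a::euclidean_space set \<Rightarrow> ('a \<Rightarrow> 'a) \<Rightarrow> real" where
  "trace_on T L = (let B = (SOME B. independent B \<and> span B = T)
     in \<Sum>b\<in>B. representation B (L b) b)"

definition laplacian ::
    "('m, 'a::euclidean_space) rchart \<Rightarrow> 'm set \<Rightarrow> ('m \<Rightarrow> real) \<Rightarrow> 'm \<Rightarrow> real" where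
  "laplacian c U f p = trace_on UNIV (cov_deriv c U (\<lambda>d. grad d U f) p)"

definition harmonic_on ::
    "('m, 'a::euclidean_space) rchart set \<Rightarrow> 'm set \<Rightarrow> ('m \<Rightarrow> real) \<Rightarrow> bool" where
  "harmonic_on M U f \<longleftrightarrow> (\<forall>c\<in>M. \<forall>p\<in>U \<inter> chart_dom c. laplacian c U f p = 0)"

definition horizontally_homothetic_on ::
    "('m, 'a::euclidean_space) rchart set \<Rightarrow> 'm set \<Rightarrow> ('m \<Rightarrow> real) \<Rightarrow> bool" where
  "horizontally_homothetic_on M U f \<longleftrightarrow> (\<forall>c\<in>M. \<forall>p\<in>U \<inter> chart_dom c.
     rinner c p (grad c U f p) (grad c U (\<lambda>q. rnorm c q (grad c U f q)) p) = 0)"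


section \<open>Hypersurfaces\<close>

definition hypersurface ::
    "('m, 'a::euclidean_space) rchart set \<Rightarrow> 'm set \<Rightarrow> bool" where
  "hypersurface M S \<longleftrightarrow> S \<subseteq> carrier_of M \<and>
     (\<forall>p\<in>S. \<exists>c\<in>M. p \<in> chart_dom c \<and>
        (\<exists>V (f :: 'a \<Rightarrow> real). open V \<and> coord c p \<in> V \<and> V \<subseteq> coord c ` chart_dom c \<and>
           smooth_on V f \<and> (\<forall>x\<in>V. frechet_derivative f (at x) \<noteq> (\<lambda>v. 0)) \<and>
           V \<inter> coord c ` (S \<inter> chart_dom c) = {x \<in> V. f x = 0}))"

definition unit_normal_field :: "('m, 'a::euclidean_space) rchart set \<Rightarrow> 'm set \<Rightarrow>
    (('m, 'a) rchart \<Rightarrow> 'm \<Rightarrow> 'a) \<Rightarrow> bool" where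
  "unit_normal_field M S N \<longleftrightarrow> smooth_field_along M S N \<and>
     (\<forall>c\<in>M. \<forall>p\<in>S \<inter> chart_dom c. rnorm c p (N c p) = 1 \<and>
        (\<forall>v\<in>tangent_space c S p. rinner c p (N c p) v = 0))"

definition shape_operator :: "('m, 'a::euclidean_space) rchart \<Rightarrow> 'm set \<Rightarrow>
    (('m, 'a) rchart \<Rightarrow> 'm \<Rightarrow> 'a) \<Rightarrow> 'm \<Rightarrow> 'a \<Rightarrow> 'a" where
  "shape_operator c S N p v = - cov_deriv c S N p v"

definition mean_curvature :: "('m, 'a::euclidean_space) rchart \<Rightarrow> 'm set \<Rightarrow>
    (('m, 'a) rchart \<Rightarrow> 'm \<Rightarrow> 'a) \<Rightarrow> 'm \<Rightarrow> real" where
  "mean_curvature c S N p = trace_on (tangent_space c S p) (shape_operator c S N p)"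

text \<open>
  Vanishing of the mean curvature does not depend on the choice of the unit normal, so local
  unit normals suffice and minimal hypersurfaces need not be orientable.
\<close>

definition minimal_hypersurface ::
    "('m::topological_space, 'a::euclidean_space) rchart set \<Rightarrow> 'm set \<Rightarrow> bool" where
  "minimal_hypersurface M S \<longleftrightarrow> hypersurface M S \<and>
     (\<forall>p\<in>S. \<exists>V N. open V \<and> p \<in> V \<and> unit_normal_field M (S \<inter> V) N \<and>
        (\<forall>c\<in>M. \<forall>q\<in>S \<inter> V \<inter> chart_dom c. mean_curvature c (S \<inter> V) N q = 0))"


section \<open>Hypersurfaces in the product with the line\<close>

definition graph_on :: "'m set \<Rightarrow> ('m \<Rightarrow> real) \<Rightarrow> ('m \<times> real) set" where
  "graph_on U f = {(p, f p) | p. p \<in> U}"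

definition angle_function :: "('m \<times> real, 'a::euclidean_space \<times> real) rchart \<Rightarrow>
    (('m \<times> real, 'a \<times> real) rchart \<Rightarrow> 'm \<times> real \<Rightarrow> 'a \<times> real) \<Rightarrow> 'm \<times> real \<Rightarrow> real" where
  "angle_function c N p = rinner c p (N c p) (0, 1)"

definition nonconstant_angle :: "('m, 'a::euclidean_space) rchart set \<Rightarrow> ('m \<times> real) set \<Rightarrow>
    (('m \<times> real, 'a \<times> real) rchart \<Rightarrow> 'm \<times> real \<Rightarrow> 'a \<times> real) \<Rightarrow> bool" where
  "nonconstant_angle M S N \<longleftrightarrow>
     \<not> (\<exists>k. \<forall>c\<in>prod_line M. \<forall>p\<in>S \<inter> chart_dom c. angle_function c N p = k)"

text \<open>The height function is \<open>snd\<close>.\<close>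

definition height_grad ::
    "('m \<times> real, 'a::euclidean_space \<times> real) rchart \<Rightarrow> ('m \<times> real) set \<Rightarrow> 'm \<times> real \<Rightarrow> 'a \<times> real"
  where "height_grad c S p = grad c S snd p"

definition horizontal_point ::
    "('m, 'a::euclidean_space) rchart set \<Rightarrow> ('m \<times> real) set \<Rightarrow> 'm \<times> real \<Rightarrow> bool" where
  "horizontal_point M S p \<longleftrightarrow> p \<in> S \<and>
     (\<exists>c\<in>prod_line M. p \<in> chart_dom c \<and> height_grad c S p = 0)"

text \<open>
  The slice of height \<open>t\<close>, which is isometric to \<open>M\<close> by projection, is identified with \<open>M\<close>.
  Away from horizontal points every intersection with a slice is transversal.
\<close>

definition horizontal_section :: "('m \<times> real) set \<Rightarrow> real \<Rightarrow> 'm set" where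
  "horizontal_section S t = {p. (p, t) \<in> S}"

definition vertical_helicoid :: "('m::topological_space, 'a::euclidean_space) rchart set \<Rightarrow>
    ('m \<times> real) set \<Rightarrow>
    (('m \<times> real, 'a \<times> real) rchart \<Rightarrow> 'm \<times> real \<Rightarrow> 'a \<times> real) \<Rightarrow> bool" where
  "vertical_helicoid M S N \<longleftrightarrow>
     hypersurface (prod_line M) S \<and> unit_normal_field (prod_line M) S N \<and>
     (\<forall>p. \<not> horizontal_point M S p) \<and>
     nonconstant_angle M S N \<and>
     (\<forall>t. minimal_hypersurface M (horizontal_section S t)) \<and>
     (\<forall>c\<in>prod_line M. \<forall>p\<in>S \<inter> chart_dom c.
        rinner c p (shape_operator c S N p (height_grad c S p)) (height_grad c S p) = 0)"

end

theory Submission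
  imports Defs
begin

text \<open>
  Let \<open>n\<close> be the gradient of \<open>u\<close>, \<open>L\<close> its Laplacian and \<open>Q\<close> the inner product of the covariant
  derivative of \<open>n\<close> along \<open>n\<close> with \<open>n\<close>; by compatibility with the metric \<open>Q\<close> is half the
  derivative of \<open>|n|^2\<close> along \<open>n\<close>. A unit normal of the graph has the form \<open>l (- n, 1)\<close> with
  \<open>l^2 (1 + |n|^2) = 1\<close>, a unit normal of a level set the form \<open>m n\<close> with \<open>m^2 |n|^2 = 1\<close>.
  Differentiating these identities gives, up to nonvanishing factors, four pointwise formulas: the
  mean curvature of the graph is \<open>(1 + |n|^2) L - Q\<close>, that of the level set is \<open>|n|^2 L - Q\<close>,
  the second fundamental form of the graph on the gradient of the height is \<open>Q\<close>, and the horizontal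
  homothety condition reads \<open>Q = 0\<close>. Each of the three conditions therefore means
  \<open>L = Q = 0\<close>. The signs of \<open>l\<close> and \<open>m\<close> never matter, and neither does the symmetry of the Hessian.
\<close>

section \<open>Calculus of smooth maps\<close>

text \<open>Two obstacles shape the work. The first is regularity: tangent vectors are velocities of
  smooth curves, so a vector annihilated by the differential of \<open>u\<close> has to be realised
  by a smooth curve inside a level set. The second is that minimality only supplies some unit normal
  on some open piece around each point. The formulas are therefore proved in a single chart, for
  graphs and level sets over an arbitrary open \<open>U\<close> and for any unit normal there, while
  gradient and Laplacian are always taken over one fixed larger domain. For the converse
  implications normals must be exhibited: the given \<open>N\<close> for the graph, its normalised
  horizontal part for the level sets. The factor \<open>1 + |n|^2\<close> is the squared length of
  \<open>(- n, 1)\<close>, and \<open>|n|^2\<close> that of \<open>n\<close>. The two mean curvature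
  expressions differ by exactly \<open>L\<close>, which is how harmonicity ties minimality of the
  graph to minimality of its sections.\<close>

lemma C_k_on_Suc_has_derivative:
  assumes "C_k_on (Suc k) S f" "open S" "x \<in> S"
  shows "(f has_derivative frechet_derivative f (at x)) (at x)"
proof -
  have "f differentiable (at x within S)"
    using assms(1,3) by (simp add: differentiable_on_def)
  then show ?thesis
    unfolding at_within_open[OF assms(3,2)] by (rule frechet_derivative_works[THEN iffD1])
qed

text \<open>\<open>C_k_on\<close> takes derivatives in the full space, so equality of two maps on
  \<open>S\<close> passes to their derivatives because \<open>S\<close> is open.\<close>

lemma C_k_on_cong:
  assumes "open S" "\<And>x. x \<in> S \<Longrightarrow> f x = g x" "C_k_on k S f"
  shows "C_k_on k S g"
  using assms
proof (induction k arbitrary: f g)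
  case 0
  then show ?case using continuous_on_cong[of S S f g] by simp
next
  case (Suc k)
  have dg: "(g has_derivative frechet_derivative f (at x)) (at x)" if "x \<in> S" for x
    by (rule has_derivative_transform_within_open[OF C_k_on_Suc_has_derivative[OF Suc.prems(3,1) that] Suc.prems(1) that Suc.prems(2)])
  then have "g differentiable_on S"
    by (auto simp: differentiable_on_def differentiable_def intro: has_derivative_at_withinI)
  moreover have "C_k_on k S (\<lambda>x. frechet_derivative g (at x) v)" for v
    by (rule Suc.IH[OF Suc.prems(1), of "\<lambda>x. frechet_derivative f (at x) v"])
      (use Suc.prems(3) in \<open>simp_all add: frechet_derivative_at[OF dg]\<close>)
  ultimately show ?case by simp
qed

text \<open>Lets an explicit formula \<open>f'\<close> stand for the Frechet derivative; most
  inductions on the order below go through this rule.\<close>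

lemma C_k_on_Suc_intro:
  assumes "open S" and d: "\<And>x. x \<in> S \<Longrightarrow> (f has_derivative f' x) (at x)"
    and "\<And>v. C_k_on k S (\<lambda>x. f' x v)"
  shows "C_k_on (Suc k) S f"
proof -
  have "f differentiable_on S"
    using d by (auto simp: differentiable_on_def differentiable_def intro: has_derivative_at_withinI)
  moreover have "C_k_on k S (\<lambda>x. frechet_derivative f (at x) v)" for v
    by (rule C_k_on_cong[OF assms(1) _ assms(3)[of v]]) (simp add: frechet_derivative_at[OF d])
  ultimately show ?thesis by simp
qed

lemma C_k_on_SucD: "C_k_on (Suc k) S f \<Longrightarrow> C_k_on k S f"
  by (induction k arbitrary: f) (auto simp: differentiable_imp_continuous_on)

lemma C_k_on_subset: "C_k_on k S f \<Longrightarrow> T \<subseteq> S \<Longrightarrow> C_k_on k T f"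
  by (induction k arbitrary: f) (auto intro: continuous_on_subset differentiable_on_subset)

lemma C_k_on_const: "C_k_on k S (\<lambda>x. c)"
  by (induction k arbitrary: c) auto

lemma C_k_on_bounded_linear:
  assumes "bounded_linear L" "open S"
  shows "C_k_on k S L"
proof (cases k)
  case 0
  then show ?thesis using assms by (simp add: linear_continuous_on)
next
  case (Suc j)
  show ?thesis unfolding Suc
    by (rule C_k_on_Suc_intro[OF assms(2), where f' = "\<lambda>x. L"])
      (use assms in \<open>auto intro: bounded_linear_imp_has_derivative C_k_on_const\<close>)
qed

lemma C_k_on_linear_compose:
  assumes "bounded_linear L" "open S" "C_k_on k S f"
  shows "C_k_on k S (\<lambda>x. L (f x))"
  using assms(3)
proof (induction k arbitrary: f)
  case 0
  then show ?case using bounded_linear.continuous_on[OF assms(1)] by auto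
next
  case (Suc k)
  show ?case
  proof (rule C_k_on_Suc_intro[OF assms(2), where f' = "\<lambda>x v. L (frechet_derivative f (at x) v)"])
    show "((\<lambda>x. L (f x)) has_derivative (\<lambda>v. L (frechet_derivative f (at x) v))) (at x)" if "x \<in> S" for x
      by (rule bounded_linear.has_derivative[OF assms(1) C_k_on_Suc_has_derivative[OF Suc.prems assms(2) that]])
    show "C_k_on k S (\<lambda>x. L (frechet_derivative f (at x) v))" for v
      using Suc by simp
  qed
qed

lemma C_k_on_add:
  assumes "open S" "C_k_on k S f" "C_k_on k S g"
  shows "C_k_on k S (\<lambda>x. f x + g x)"
  using assms(2,3)
proof (induction k arbitrary: f g)
  case 0
  then show ?case by (simp add: continuous_on_add)
next
  case (Suc k)
  show ?case
    by (rule C_k_on_Suc_intro[OF assms(1), where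
          f' = "\<lambda>x v. frechet_derivative f (at x) v + frechet_derivative g (at x) v"])
      (use Suc in \<open>auto intro!: has_derivative_add C_k_on_Suc_has_derivative[of k S] assms(1)\<close>)
qed

lemma C_k_on_sum:
  assumes "open S" "\<And>i. i \<in> I \<Longrightarrow> C_k_on k S (f i)"
  shows "C_k_on k S (\<lambda>x. \<Sum>i\<in>I. f i x)"
  using assms(2)
  by (induction I rule: infinite_finite_induct) (auto simp: C_k_on_const C_k_on_add assms(1))

lemma C_k_on_scaleR:
  fixes r :: "'a::euclidean_space \<Rightarrow> real"
  assumes "open S" "C_k_on k S r" "C_k_on k S f"
  shows "C_k_on k S (\<lambda>x. r x *\<^sub>R f x)"
  using assms(2,3)
proof (induction k arbitrary: r f)
  case 0
  then show ?case by (simp add: continuous_on_scaleR)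
next
  case (Suc k)
  show ?case
  proof (rule C_k_on_Suc_intro[OF assms(1), where
        f' = "\<lambda>x v. r x *\<^sub>R frechet_derivative f (at x) v + frechet_derivative r (at x) v *\<^sub>R f x"])
    \<comment> \<open>The Leibniz rule contains \<open>r\<close> and \<open>f\<close> themselves,
      which are needed one order lower; hence \<open>C_k_on_SucD\<close>.\<close>
    show "C_k_on k S (\<lambda>x. r x *\<^sub>R frechet_derivative f (at x) v + frechet_derivative r (at x) v *\<^sub>R f x)" for v
      using Suc.prems C_k_on_SucD[OF Suc.prems(1)] C_k_on_SucD[OF Suc.prems(2)]
      by (intro C_k_on_add[OF assms(1)] Suc.IH) auto
  qed (intro has_derivative_scaleR C_k_on_Suc_has_derivative[OF Suc.prems(1) assms(1)]
       C_k_on_Suc_has_derivative[OF Suc.prems(2) assms(1)])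
qed

lemma C_k_on_mult:
  fixes r f :: "'a::euclidean_space \<Rightarrow> real"
  assumes "open S" "C_k_on k S r" "C_k_on k S f"
  shows "C_k_on k S (\<lambda>x. r x * f x)"
  using C_k_on_scaleR[OF assms] by simp

text \<open>In the chain rule the derivative of \<open>f\<close> is applied to a direction that
  itself moves with \<open>x\<close>. Expanding that direction over \<open>Basis\<close> leaves
  products of scalar coefficients with compositions of partial derivatives, to which the induction
  hypothesis applies.\<close>

lemma C_k_on_compose:
  fixes h :: "'a::euclidean_space \<Rightarrow> 'b::euclidean_space"
  assumes "open S" "open T" "h ` S \<subseteq> T" "C_k_on k S h" "C_k_on k T f"
  shows "C_k_on k S (\<lambda>x. f (h x))"
  using assms(4,5)
proof (induction k arbitrary: f)
  case 0
  then show ?case using continuous_on_compose2[OF _ _ assms(3)] by simp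
next
  case (Suc k)
  note dh = C_k_on_Suc_has_derivative[OF Suc.prems(1) assms(1)]
  note df = C_k_on_Suc_has_derivative[OF Suc.prems(2) assms(2)]
  show ?case
  proof (rule C_k_on_Suc_intro[OF assms(1), where
        f' = "\<lambda>x v. \<Sum>b\<in>Basis. (frechet_derivative h (at x) v \<bullet> b) *\<^sub>R frechet_derivative f (at (h x)) b"])
    fix x assume x: "x \<in> S"
    then have "h x \<in> T" using assms(3) by auto
    note d = df[OF this]
    have "((\<lambda>x. f (h x)) has_derivative (\<lambda>v. frechet_derivative f (at (h x)) (frechet_derivative h (at x) v))) (at x)"
      using has_derivative_compose[OF dh[OF x] d] .
    moreover have "frechet_derivative f (at (h x)) w = (\<Sum>b\<in>Basis. (w \<bullet> b) *\<^sub>R frechet_derivative f (at (h x)) b)" for w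
    proof -
      have "frechet_derivative f (at (h x)) (\<Sum>b\<in>Basis. (w \<bullet> b) *\<^sub>R b)
          = (\<Sum>b\<in>Basis. (w \<bullet> b) *\<^sub>R frechet_derivative f (at (h x)) b)"
        using linear_sum[OF has_derivative_linear[OF d], of "\<lambda>b. (w \<bullet> b) *\<^sub>R b" Basis]
        by (simp only: linear_cmul[OF has_derivative_linear[OF d]])
      then show ?thesis by (simp only: euclidean_representation)
    qed
    then have "(\<lambda>v. frechet_derivative f (at (h x)) (frechet_derivative h (at x) v)) =
        (\<lambda>v. \<Sum>b\<in>Basis. (frechet_derivative h (at x) v \<bullet> b) *\<^sub>R frechet_derivative f (at (h x)) b)"
      by (rule ext)
    ultimately show "((\<lambda>x. f (h x)) has_derivative
      (\<lambda>v. \<Sum>b\<in>Basis. (frechet_derivative h (at x) v \<bullet> b) *\<^sub>R frechet_derivative f (at (h x)) b)) (at x)"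
      by (simp only:)
  next
    show "C_k_on k S (\<lambda>x. \<Sum>b\<in>Basis. (frechet_derivative h (at x) v \<bullet> b) *\<^sub>R frechet_derivative f (at (h x)) b)" for v
    proof (intro C_k_on_sum C_k_on_scaleR assms(1))
      fix b :: 'b
      show "C_k_on k S (\<lambda>x. frechet_derivative h (at x) v \<bullet> b)"
        using Suc.prems(1) by (intro C_k_on_linear_compose[OF bounded_linear_inner_left assms(1)]) auto
      show "C_k_on k S (\<lambda>x. frechet_derivative f (at (h x)) b)"
        using Suc.IH[OF C_k_on_SucD[OF Suc.prems(1)], of "\<lambda>y. frechet_derivative f (at y) b"] Suc.prems(2) by simp
    qed
  qed
qed

lemma C_k_on_Pair:
  assumes "open S" "C_k_on k S f" "C_k_on k S g"
  shows "C_k_on k S (\<lambda>x. (f x, g x))"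
proof -
  have "C_k_on k S (\<lambda>x. (f x, 0) + (0, g x))"
    using assms by (intro C_k_on_add C_k_on_linear_compose[where L = "\<lambda>x. (x, 0)"]
        C_k_on_linear_compose[where L = "\<lambda>x. (0, x)"])
      (auto intro!: bounded_linear_Pair bounded_linear_ident bounded_linear_zero)
  then show ?thesis by simp
qed

text \<open>The derivative is a polynomial in \<open>inverse\<close> itself, so each order feeds the
  next.\<close>

lemma C_k_on_inverse:
  "C_k_on k (- {0::real}) inverse"
proof (induction k)
  case 0
  then show ?case by (auto intro!: continuous_intros)
next
  case (Suc k)
  show ?case
  proof (rule C_k_on_Suc_intro[where f' = "\<lambda>x v. - (inverse x * v * inverse x)"])
    show "C_k_on k (- {0}) (\<lambda>x. - (inverse x * v * inverse x :: real))" for v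
      using C_k_on_linear_compose[OF bounded_linear_mult_right[of "-v"] _ C_k_on_mult[OF _ Suc Suc]]
      by (simp add: mult_ac open_Compl)
  qed (auto intro!: has_derivative_inverse' simp: open_Compl)
qed

text \<open>The derivative is a multiple of \<open>inverse\<close> after \<open>sqrt\<close>, so the
  induction hypothesis is composed with \<open>C_k_on_inverse\<close>.\<close>

lemma C_k_on_sqrt: "C_k_on k {0<..} sqrt"
proof (induction k)
  case 0
  then show ?case by (auto intro!: continuous_intros)
next
  case (Suc k)
  show ?case
  proof (rule C_k_on_Suc_intro[where f' = "\<lambda>x v. v * (inverse (sqrt x) / 2)"])
    show "C_k_on k {0<..} (\<lambda>x. v * (inverse (sqrt x) / 2))" for v
      using C_k_on_linear_compose[OF bounded_linear_mult_right[of "v/2"] _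
          C_k_on_compose[OF _ _ _ Suc C_k_on_inverse]]
      by (force simp: mult_ac open_Compl)
    show "(sqrt has_derivative (\<lambda>v. v * (inverse (sqrt x) / 2))) (at x)" if "x \<in> {0<..}" for x
    proof -
      have "(*) (inverse (sqrt x) / 2) = (\<lambda>v. v * (inverse (sqrt x) / 2))"
        by (rule ext) (rule mult.commute)
      then show ?thesis
        using DERIV_real_sqrt[of x] that unfolding has_field_derivative_def by simp
    qed
  qed auto
qed

section \<open>Closure properties of maps smooth to all orders\<close>

lemma smooth_on_cong: "open S \<Longrightarrow> (\<And>x. x \<in> S \<Longrightarrow> f x = g x) \<Longrightarrow> smooth_on S f \<Longrightarrow> smooth_on S g"
  unfolding smooth_on_def by (rule allI, rule C_k_on_cong[of S f g]) auto

lemma smooth_on_subset: "smooth_on S f \<Longrightarrow> T \<subseteq> S \<Longrightarrow> smooth_on T f"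
  unfolding smooth_on_def using C_k_on_subset by metis

lemma smooth_on_const: "smooth_on S (\<lambda>x. c)"
  by (simp add: smooth_on_def C_k_on_const)

lemma smooth_on_bounded_linear: "bounded_linear L \<Longrightarrow> open S \<Longrightarrow> smooth_on S L"
  unfolding smooth_on_def by (rule allI, rule C_k_on_bounded_linear) auto

lemma smooth_on_linear_compose:
  "bounded_linear L \<Longrightarrow> open S \<Longrightarrow> smooth_on S f \<Longrightarrow> smooth_on S (\<lambda>x. L (f x))"
  unfolding smooth_on_def by (rule allI, rule C_k_on_linear_compose) auto

lemma smooth_on_add: "open S \<Longrightarrow> smooth_on S f \<Longrightarrow> smooth_on S g \<Longrightarrow> smooth_on S (\<lambda>x. f x + g x)"
  unfolding smooth_on_def by (rule allI, rule C_k_on_add) auto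

lemma smooth_on_sum:
  "open S \<Longrightarrow> (\<And>i. i \<in> I \<Longrightarrow> smooth_on S (f i)) \<Longrightarrow> smooth_on S (\<lambda>x. \<Sum>i\<in>I. f i x)"
  unfolding smooth_on_def by (rule allI, rule C_k_on_sum) auto

lemma smooth_on_scaleR:
  "open S \<Longrightarrow> smooth_on S r \<Longrightarrow> smooth_on S f \<Longrightarrow> smooth_on S (\<lambda>x. r x *\<^sub>R f x)"
  unfolding smooth_on_def by (rule allI, rule C_k_on_scaleR) auto

lemma smooth_on_compose:
  fixes h :: "'a::euclidean_space \<Rightarrow> 'b::euclidean_space"
  shows "open S \<Longrightarrow> open T \<Longrightarrow> h ` S \<subseteq> T \<Longrightarrow> smooth_on S h \<Longrightarrow> smooth_on T f \<Longrightarrow> smooth_on S (\<lambda>x. f (h x))"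
  unfolding smooth_on_def by (rule allI, rule C_k_on_compose[of S T h]) auto

lemma smooth_on_Pair:
  "open S \<Longrightarrow> smooth_on S f \<Longrightarrow> smooth_on S g \<Longrightarrow> smooth_on S (\<lambda>x. (f x, g x))"
  unfolding smooth_on_def by (rule allI, rule C_k_on_Pair) auto

lemma smooth_on_inverse_sqrt:
  assumes "open S" "smooth_on S f" "\<And>x. x \<in> S \<Longrightarrow> f x > 0"
  shows "smooth_on S (\<lambda>x. inverse (sqrt (f x)))"
proof -
  have "smooth_on {0<..} sqrt" "smooth_on (- {0::real}) inverse"
    by (simp_all add: smooth_on_def C_k_on_sqrt C_k_on_inverse)
  then have "smooth_on {0<..} (\<lambda>x::real. inverse (sqrt x))"
    by (rule smooth_on_compose[where T = "- {0}" and h = sqrt, rotated -2]) (auto simp: open_Compl)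
  then show ?thesis
    using assms by (rule_tac smooth_on_compose[where T = "{0<..}" and h = f]) auto
qed

lemma smooth_on_has_derivative:
  "smooth_on S f \<Longrightarrow> open S \<Longrightarrow> x \<in> S \<Longrightarrow> (f has_derivative frechet_derivative f (at x)) (at x)"
  unfolding smooth_on_def using C_k_on_Suc_has_derivative by blast

lemma smooth_on_continuous: "smooth_on S f \<Longrightarrow> continuous_on S f"
  unfolding smooth_on_def using C_k_on.simps(1) by blast

lemma smooth_on_frechet_derivative:
  "smooth_on S f \<Longrightarrow> smooth_on S (\<lambda>x. frechet_derivative f (at x) v)"
  unfolding smooth_on_def
proof
  fix k assume "\<forall>k. C_k_on k S f"
  then have "C_k_on (Suc k) S f" ..
  then show "C_k_on k S (\<lambda>x. frechet_derivative f (at x) v)" by simp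
qed

section \<open>Curves in level sets and traces of endomorphisms\<close>

text \<open>Provides the nontrivial inclusion in \<open>tangent_space_level\<close>, since tangent
  vectors are defined as velocities of smooth curves.\<close>

lemma smooth_curve_in_level_set:
  fixes f :: "'a::euclidean_space \<Rightarrow> real"
  assumes U: "open U" "x0 \<in> U" and f: "smooth_on U f"
    and v: "frechet_derivative f (at x0) v = 0" and nz: "frechet_derivative f (at x0) \<noteq> (\<lambda>v. 0)"
  obtains \<gamma> e where "e > 0" "smooth_on {-e<..<e} \<gamma>" "\<And>s. s \<in> {-e<..<e} \<Longrightarrow> \<gamma> s \<in> U \<and> f (\<gamma> s) = f x0"
    "\<gamma> 0 = x0" "(\<gamma> has_vector_derivative v) (at (0::real))"
proof -
  define D where "D x = frechet_derivative f (at x)" for x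
  have D: "(f has_derivative D x) (at x)" if "x \<in> U" for x
    unfolding D_def using smooth_on_has_derivative[OF f U(1) that] .
  have lD: "linear (D x)" if "x \<in> U" for x using D[OF that] by (rule has_derivative_linear)
  note lD0 = lD[OF U(2)]
  obtain w0 where "D x0 w0 \<noteq> 0" using nz unfolding D_def by auto
  define w where "w = (1 / D x0 w0) *\<^sub>R w0"
  have w: "D x0 w = 1" unfolding w_def using \<open>D x0 w0 \<noteq> 0\<close> by (simp add: linear_cmul[OF lD0])
  have w0: "w \<noteq> 0" using w linear_0[OF lD0] by auto
  \<comment> \<open>\<open>D x0 (\<Phi> x) = f x - f x0\<close> and \<open>\<Phi>\<close> has derivative \<open>id\<close> at \<open>x0\<close>: its inverse maps the line along \<open>v\<close> into
    the level set. Only \<open>C^1\<close> regularity comes from the inverse function theorem; since the curve \<open>\<gamma>\<close>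
    stays in \<open>x0 + s v + span w\<close>, it solves a first order equation whose right side is as
    smooth as \<open>\<gamma>\<close>, which bootstraps.\<close>
  define \<Phi> where "\<Phi> x = (x - x0) + (f x - f x0 - D x0 (x - x0)) *\<^sub>R w" for x
  define P where "P x = Blinfun (\<lambda>z. z + (D x z - D x0 z) *\<^sub>R w)" for x
  have bl: "bounded_linear (\<lambda>z. z + (D x z - D x0 z) *\<^sub>R w)" if "x \<in> U" for x
    using has_derivative_bounded_linear[OF D[OF that]] has_derivative_bounded_linear[OF D[OF U(2)]]
    by (intro bounded_linear_add bounded_linear_scaleR_const bounded_linear_sub bounded_linear_ident)
  have P: "blinfun_apply (P x) z = z + (D x z - D x0 z) *\<^sub>R w" if "x \<in> U" for x z
    unfolding P_def by (simp add: bounded_linear_Blinfun_apply[OF bl[OF that]])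
  have derP: "(\<Phi> has_derivative blinfun_apply (P x)) (at x)" if "x \<in> U" for x
  proof -
    have "(\<Phi> has_derivative (\<lambda>z. (z - 0) + (D x z - 0 - D x0 (z - 0)) *\<^sub>R w)) (at x)"
      unfolding \<Phi>_def
      by (intro has_derivative_add has_derivative_diff has_derivative_scaleR_left
        has_derivative_ident has_derivative_const D[OF that]
        bounded_linear.has_derivative[OF has_derivative_bounded_linear[OF D[OF U(2)]]])
    moreover have "(\<lambda>z. (z - 0) + (D x z - 0 - D x0 (z - 0)) *\<^sub>R w) = blinfun_apply (P x)"
      by (rule ext) (simp add: P[OF that])
    ultimately show ?thesis by simp
  qed
  have contP: "continuous_on U P"
  proof (rule continuous_on_blinfun_componentwise)
    fix i :: 'a
    have "continuous_on U (\<lambda>x. i + (D x i - D x0 i) *\<^sub>R w)"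
      using smooth_on_continuous[OF smooth_on_frechet_derivative[OF f, of i]]
      unfolding D_def by (intro continuous_intros) auto
    then show "continuous_on U (\<lambda>x. blinfun_apply (P x) i)"
      by (rule continuous_on_eq) (simp add: P)
  qed
  have inv: "id_blinfun o\<^sub>L P x0 = id_blinfun"
    by (rule blinfun_eqI) (simp add: P[OF U(2)])
  obtain U' V g g' where *: "open U'" "U' \<subseteq> U" "x0 \<in> U'" "open V" "\<Phi> x0 \<in> V" "homeomorphism U' V \<Phi> g"
    "\<And>y. y \<in> V \<Longrightarrow> (g has_derivative (g' y)) (at y)"
    "\<And>y. y \<in> V \<Longrightarrow> g' y = inv (blinfun_apply (P (g y)))"
    "\<And>y. y \<in> V \<Longrightarrow> bij (blinfun_apply (P (g y)))"
    using inverse_function_theorem[OF U(1) derP contP U(2) inv] by blast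
  have gV: "g y \<in> U" "\<Phi> (g y) = y" if "y \<in> V" for y
    using *(2,6) that unfolding homeomorphism_def by auto
  have \<Phi>0: "\<Phi> x0 = 0" by (simp add: \<Phi>_def linear_0[OF lD0])
  have g0: "g 0 = x0" using *(3,6) \<Phi>0 unfolding homeomorphism_def by metis
  have "open ((\<lambda>s. s *\<^sub>R v) -` V)"
    by (intro open_vimage *(4) continuous_intros)
  moreover have "0 \<in> (\<lambda>s. s *\<^sub>R v) -` V" using *(5) \<Phi>0 by simp
  ultimately obtain e where e: "e > 0" "ball 0 e \<subseteq> (\<lambda>s. s *\<^sub>R v) -` V"
    using open_contains_ball by blast
  let ?I = "{-e<..<e}"
  have V: "s *\<^sub>R v \<in> V" if "s \<in> ?I" for s using e(2) that by (auto simp: dist_real_def subset_iff)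
  define \<gamma> where "\<gamma> s = g (s *\<^sub>R v)" for s
  have \<gamma>U: "\<gamma> s \<in> U" if "s \<in> ?I" for s using gV V that \<gamma>_def by auto
  have level: "f (\<gamma> s) = f x0" if s: "s \<in> ?I" for s
  proof -
    have "D x0 (\<Phi> (\<gamma> s)) = f (\<gamma> s) - f x0"
      by (simp add: \<Phi>_def linear_add[OF lD0] linear_cmul[OF lD0] w)
    moreover have "\<Phi> (\<gamma> s) = s *\<^sub>R v" unfolding \<gamma>_def using gV V s by simp
    ultimately show ?thesis using v by (simp add: linear_cmul[OF lD0] D_def[symmetric])
  qed
  \<comment> \<open>Differentiating \<open>\<Phi> (\<gamma> s) = s *\<^sub>R v\<close> gives
    \<open>P (\<gamma> s) z = v\<close> for the velocity \<open>z\<close>. This puts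
    \<open>z\<close> into \<open>v\<close> plus the span of \<open>w\<close>, and tangency to the
    level set fixes the coefficient. The number \<open>D (\<gamma> s) w\<close> is nonzero because
    it is the eigenvalue of the bijection \<open>P (\<gamma> s)\<close> on \<open>w\<close>.\<close>
  have Dw: "D (\<gamma> s) w \<noteq> 0"
    and d\<gamma>: "(\<gamma> has_derivative (\<lambda>h. h *\<^sub>R (v - (D (\<gamma> s) v * inverse (D (\<gamma> s) w)) *\<^sub>R w))) (at s)"
    if s: "s \<in> ?I" for s
  proof -
    let ?F = "D (\<gamma> s)"
    note Pg = P[OF \<gamma>U[OF s]]
    have lF: "linear ?F" using lD \<gamma>U s by auto
    have bij: "bij (blinfun_apply (P (\<gamma> s)))" unfolding \<gamma>_def using *(9)[OF V[OF s]] .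
    have Pw: "blinfun_apply (P (\<gamma> s)) w = ?F w *\<^sub>R w" by (simp add: Pg w algebra_simps)
    show nz: "?F w \<noteq> 0"
    proof
      assume "?F w = 0"
      then have "blinfun_apply (P (\<gamma> s)) w = blinfun_apply (P (\<gamma> s)) 0" using Pw by (simp add: blinfun.zero_right)
      then show False using bij w0 unfolding bij_def inj_def by blast
    qed
    define z where "z = g' (s *\<^sub>R v) v"
    have "blinfun_apply (P (\<gamma> s)) z = v"
      unfolding z_def *(8)[OF V[OF s]] \<gamma>_def[symmetric] using bij by (simp add: bij_is_surj surj_f_inv_f)
    then have z: "z + (?F z - D x0 z) *\<^sub>R w = v" using Pg by simp
    \<comment> \<open>Since \<open>D x0 w = 1\<close>, the two terms \<open>D x0 z\<close> cancel
      and only \<open>?F z\<close> remains.\<close>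
    then have "D x0 (z + (?F z - D x0 z) *\<^sub>R w) = 0" using v D_def by simp
    then have Fz: "?F z = 0" by (simp add: linear_add[OF lD0] linear_cmul[OF lD0] w)
    have zv: "z = v + D x0 z *\<^sub>R w" using z Fz by (simp add: algebra_simps)
    have "?F v + D x0 z * ?F w = 0"
      using Fz arg_cong[OF zv, of ?F] by (simp add: linear_add[OF lF] linear_cmul[OF lF])
    then have "D x0 z = - (?F v * inverse (?F w))" using nz by (simp add: field_simps)
    then have zf: "z = v - (?F v * inverse (?F w)) *\<^sub>R w" using zv by simp
    have "(\<gamma> has_derivative (\<lambda>h. g' (s *\<^sub>R v) (h *\<^sub>R v))) (at s)"
      unfolding \<gamma>_def
      by (rule has_derivative_compose[of "\<lambda>s. s *\<^sub>R v" "\<lambda>h. h *\<^sub>R v", OF _ *(7)[OF V[OF s]]])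
        (auto intro!: derivative_eq_intros)
    moreover have "g' (s *\<^sub>R v) (h *\<^sub>R v) = h *\<^sub>R z" for h
      unfolding z_def using has_derivative_linear[OF *(7)[OF V[OF s]]] by (simp add: linear_cmul)
    ultimately show "(\<gamma> has_derivative (\<lambda>h. h *\<^sub>R (v - (?F v * inverse (?F w)) *\<^sub>R w))) (at s)"
      using zf by simp
  qed
  have I: "open ?I" by simp
  have "C_k_on k ?I \<gamma>" for k
  proof (induction k)
    case 0
    show ?case using has_derivative_continuous[OF d\<gamma>]
      by (simp add: continuous_at_imp_continuous_on)
  next
    case (Suc k)
    have 1: "C_k_on k ?I (\<lambda>s. D (\<gamma> s) z)" for z
      using smooth_on_frechet_derivative[OF f, of z] \<gamma>U Suc
      unfolding D_def smooth_on_def by (intro C_k_on_compose[OF I U(1), where f = "\<lambda>x. frechet_derivative f (at x) z"]) auto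
    have 2: "C_k_on k ?I (\<lambda>s. inverse (D (\<gamma> s) w))"
      by (rule C_k_on_compose[where T = "- {0}" and h = "\<lambda>s. D (\<gamma> s) w"])
        (use Dw 1 C_k_on_inverse in \<open>auto simp: open_Compl\<close>)
    have "C_k_on k ?I (\<lambda>s. v + (D (\<gamma> s) v * inverse (D (\<gamma> s) w)) *\<^sub>R (- w))"
      by (intro C_k_on_add I C_k_on_const C_k_on_scaleR C_k_on_mult 1 2)
    then have "C_k_on k ?I (\<lambda>s. h *\<^sub>R (v - (D (\<gamma> s) v * inverse (D (\<gamma> s) w)) *\<^sub>R w))" for h
      using C_k_on_linear_compose[OF bounded_linear_scaleR_right[of h] I] by simp
    then show ?case using C_k_on_Suc_intro[OF I d\<gamma>] by blast
  qed
  then have "smooth_on ?I \<gamma>" by (simp add: smooth_on_def)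
  moreover have "\<gamma> 0 = x0" by (simp add: \<gamma>_def g0)
  moreover have "(\<gamma> has_vector_derivative v) (at 0)"
    using d\<gamma>[of 0] e(1) v \<open>\<gamma> 0 = x0\<close> by (simp add: has_vector_derivative_def D_def)
  ultimately show ?thesis using that e(1) \<gamma>U level by blast
qed

section \<open>Traces on subspaces\<close>

lemma representation_self:
  fixes B :: "'a::euclidean_space set"
  assumes "independent B" "v \<in> span B"
  shows "(\<Sum>b\<in>B. representation B v b *\<^sub>R b) = v"
  using assms by (intro sum_representation_eq) (auto simp: independent_imp_finite)

text \<open>Expanding each \<open>b\<close> over \<open>C\<close> and each \<open>L c\<close> over
  \<open>B\<close> writes both traces as the same double sum, so no matrix of a basis change has to
  be inverted.\<close>

lemma basis_trace_independent:
  fixes L :: "'a::euclidean_space \<Rightarrow> 'a"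
  assumes L: "linear L" "L ` span B \<subseteq> span B"
    and B: "independent B" and C: "independent C" "span C = span B"
  shows "(\<Sum>b\<in>B. representation B (L b) b) = (\<Sum>c\<in>C. representation C (L c) c)"
proof -
  have fB: "finite B" and fC: "finite C" using B C independent_imp_finite by auto
  have LB: "L v \<in> span B" if "v \<in> span B" for v using L(2) that by auto
  have "representation B (L b) b = (\<Sum>c\<in>C. representation C b c * representation B (L c) b)" if b: "b \<in> B" for b
  proof -
    have "L b = (\<Sum>c\<in>C. representation C b c *\<^sub>R L c)"
      using representation_self[of C b] C b span_base[of b B] linear_sum[OF L(1), of "\<lambda>c. representation C b c *\<^sub>R c" C]
      by (simp add: linear_cmul[OF L(1)])
    moreover have "L c \<in> span B" if "c \<in> C" for c
      using LB C(2) span_base[OF that] by simp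
    ultimately show ?thesis
      by (simp add: representation_sum[OF B] representation_scale[OF B] span_scale span_base)
  qed
  then have "(\<Sum>b\<in>B. representation B (L b) b) = (\<Sum>b\<in>B. \<Sum>c\<in>C. representation C b c * representation B (L c) b)"
    by simp
  also have "\<dots> = (\<Sum>c\<in>C. \<Sum>b\<in>B. representation C b c * representation B (L c) b)" by (rule sum.swap)
  also have "\<dots> = (\<Sum>c\<in>C. representation C (L c) c)"
  proof (rule sum.cong[OF refl])
    fix c assume c: "c \<in> C"
    have "L c = (\<Sum>b\<in>B. representation B (L c) b *\<^sub>R b)"
      using representation_self[OF B, of "L c"] LB C(2) c span_base[of c C] by simp
    then have "representation C (L c) c = representation C (\<Sum>b\<in>B. representation B (L c) b *\<^sub>R b) c" by simp
    also have "\<dots> = (\<Sum>b\<in>B. representation B (L c) b * representation C b c)"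
      using C by (simp add: representation_sum[OF C(1)] representation_scale[OF C(1)] span_scale span_base)
    finally show "(\<Sum>b\<in>B. representation C b c * representation B (L c) b) = representation C (L c) c"
      by (simp add: mult.commute)
  qed
  finally show ?thesis .
qed

lemma ex_basis:
  fixes T :: "'a::euclidean_space set"
  assumes "subspace T"
  obtains B where "independent B" "span B = T" "B \<subseteq> T"
  using basis_exists[of T] span_subspace[OF _ _ assms] by metis

lemma trace_on_eq:
  assumes "linear L" "L ` span B \<subseteq> span B" "independent B"
  shows "trace_on (span B) L = (\<Sum>b\<in>B. representation B (L b) b)"
proof -
  let ?C = "SOME C. independent C \<and> span C = span B"
  have "independent ?C \<and> span ?C = span B"
    by (rule someI[of _ B]) (use assms in auto)
  then have "(\<Sum>b\<in>B. representation B (L b) b) = (\<Sum>b\<in>?C. representation ?C (L b) b)"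
    using basis_trace_independent[OF assms(1,2,3)] by blast
  then show ?thesis unfolding trace_on_def Let_def by (rule sym)
qed

lemma trace_on_UNIV:
  fixes K :: "'a::euclidean_space \<Rightarrow> 'a"
  assumes "linear K"
  shows "trace_on UNIV K = (\<Sum>b\<in>Basis. K b \<bullet> b)"
proof -
  have r: "representation Basis v = (\<lambda>b. if b \<in> Basis then v \<bullet> b else 0)" for v :: 'a
  proof (rule representation_eqI)
    have s: "{b. (if b \<in> Basis then v \<bullet> b else 0) \<noteq> 0} \<subseteq> Basis" by auto
    then show "finite {b. (if b \<in> Basis then v \<bullet> b else 0) \<noteq> 0}"
      using finite_Basis finite_subset by blast
    have "(\<Sum>b | (if b \<in> Basis then v \<bullet> b else 0) \<noteq> 0. (if b \<in> Basis then v \<bullet> b else 0) *\<^sub>R b)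
        = (\<Sum>b\<in>Basis. (v \<bullet> b) *\<^sub>R b)"
      by (rule sum.mono_neutral_cong_left) (auto simp: s)
    then show "(\<Sum>b | (if b \<in> Basis then v \<bullet> b else 0) \<noteq> 0. (if b \<in> Basis then v \<bullet> b else 0) *\<^sub>R b) = v"
      by (simp add: euclidean_representation)
  qed (auto simp: independent_Basis split: if_splits)
  show ?thesis using trace_on_eq[of K Basis] assms independent_Basis by (simp add: r)
qed

text \<open>Fits the shape operator of a graph, a multiple of the Hessian plus a rank one term; the
  rank one term has trace \<open>m n\<close>.\<close>

lemma trace_on_UNIV_scale_rank_one:
  fixes K :: "'a::euclidean_space \<Rightarrow> 'a"
  assumes "linear K" "linear m"
  shows "trace_on UNIV (\<lambda>v. a *\<^sub>R K v + m v *\<^sub>R n) = a * trace_on UNIV K + m n"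
proof -
  have "m n = (\<Sum>b\<in>Basis. (n \<bullet> b) * m b)"
    using linear_sum[OF assms(2), of "\<lambda>b. (n \<bullet> b) *\<^sub>R b" Basis]
    by (simp add: euclidean_representation linear_cmul[OF assms(2)])
  moreover have "linear (\<lambda>v. a *\<^sub>R K v + m v *\<^sub>R n)"
    using assms by (auto simp: linear_iff algebra_simps)
  ultimately show ?thesis
    by (simp add: trace_on_UNIV assms inner_add_left sum.distrib sum_distrib_left mult.commute)
qed

text \<open>Conjugation by \<open>\<phi>\<close> preserves the trace. With \<open>\<phi>\<close> the
  parametrisation of the tangent space of a graph by base vectors, a trace in the product chart
  becomes one over the model space of the base.\<close>

lemma trace_on_range:
  fixes \<phi> :: "'a::euclidean_space \<Rightarrow> 'b::euclidean_space"
  assumes "linear \<phi>" "inj \<phi>" "linear L" "linear K" "\<And>v. L (\<phi> v) = \<phi> (K v)"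
  shows "trace_on (range \<phi>) L = trace_on UNIV K"
proof -
  let ?B = "\<phi> ` Basis"
  have i: "independent ?B"
    using linear_independent_injective_image[OF assms(1) independent_Basis] inj_on_subset[OF assms(2)] by blast
  have s: "span ?B = range \<phi>" using linear_span_image[OF assms(1), of Basis] by simp
  have r: "representation ?B (L (\<phi> b)) (\<phi> b) = K b \<bullet> b" if b: "b \<in> Basis" for b
  proof -
    have "L (\<phi> b) = (\<Sum>c\<in>Basis. (K b \<bullet> c) *\<^sub>R \<phi> c)"
      using linear_sum[OF assms(1), of "\<lambda>c. (K b \<bullet> c) *\<^sub>R c" Basis]
      by (simp add: assms(5) euclidean_representation linear_cmul[OF assms(1)])
    then have "representation ?B (L (\<phi> b)) (\<phi> b) = (\<Sum>c\<in>Basis. (K b \<bullet> c) * (if \<phi> b = \<phi> c then 1 else 0))"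
      by (simp add: representation_sum[OF i] representation_scale[OF i] span_scale span_base representation_basis[OF i])
    also have "\<dots> = (\<Sum>c\<in>Basis. if c = b then K b \<bullet> c else 0)"
      using assms(2) by (intro sum.cong) (auto simp: inj_def)
    also have "\<dots> = K b \<bullet> b" using b by simp
    finally show ?thesis .
  qed
  have "trace_on (range \<phi>) L = (\<Sum>b\<in>?B. representation ?B (L b) b)"
    using trace_on_eq[OF assms(3) _ i] assms(5) unfolding s by auto
  also have "\<dots> = (\<Sum>b\<in>Basis. K b \<bullet> b)"
    by (subst sum.reindex) (use assms(2) r in \<open>auto simp: inj_on_def inj_def\<close>)
  finally show ?thesis by (simp add: trace_on_UNIV assms(4))
qed

text \<open>A basis of the kernel of \<open>\<alpha>\<close> is extended by \<open>n\<close>. On the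
  kernel \<open>K\<close> and \<open>L\<close> agree up to multiples of \<open>n\<close>, which do
  not touch the diagonal entries there; the remaining diagonal entry is the
  \<open>n\<close>-coefficient of \<open>K n\<close>.\<close>

lemma trace_on_hyperplane:
  fixes \<alpha> :: "'a::euclidean_space \<Rightarrow> real"
  assumes "linear \<alpha>" "\<alpha> n \<noteq> 0" "linear K" "linear L"
    and LK: "\<And>v. \<alpha> v = 0 \<Longrightarrow> L v = K v + m v *\<^sub>R n" and LT: "\<And>v. \<alpha> v = 0 \<Longrightarrow> \<alpha> (L v) = 0"
  shows "trace_on UNIV K = trace_on {v. \<alpha> v = 0} L + \<alpha> (K n) / \<alpha> n"
proof -
  let ?T = "{v. \<alpha> v = 0}"
  have T: "subspace ?T" using assms(1) linear_0[OF assms(1)] by (auto simp: subspace_def linear_iff)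
  obtain B where B: "independent B" "span B = ?T" "B \<subseteq> ?T" using ex_basis[OF T] by metis
  let ?C = "insert n B"
  have nT: "n \<notin> span B" using B(2) assms(2) by auto
  have C: "independent ?C" using independent_insertI[OF nT B(1)] .
  have dec: "v - (\<alpha> v / \<alpha> n) *\<^sub>R n \<in> span B" for v
    using B(2) assms(1,2) by (simp add: linear_diff linear_cmul)
  have sC: "span ?C = UNIV"
  proof -
    have "v \<in> span ?C" for v
      using dec[of v] span_breakdown_eq[of v n B] by blast
    then show ?thesis by auto
  qed
  have rep: "representation ?C (w + r *\<^sub>R n) b = representation B w b + (if b = n then r else 0)"
    if w: "w \<in> span B" for w r b
  proof -
    have "representation ?C w = representation B w"
      using representation_extend[OF C w] by auto
    then show ?thesis
      using sC by (simp add: representation_add[OF C] representation_scale[OF C] representation_basis[OF C])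
  qed
  have rn: "representation B w n = 0" for w
    using nT span_base representation_ne_zero by metis
  have "trace_on UNIV K = (\<Sum>b\<in>?C. representation ?C (K b) b)"
    using trace_on_eq[OF assms(3) _ C] sC by simp
  also have "\<dots> = representation ?C (K n) n + (\<Sum>b\<in>B. representation ?C (K b) b)"
    using nT span_base independent_imp_finite[OF B(1)] by (subst sum.insert) auto
  also have "representation ?C (K n) n = \<alpha> (K n) / \<alpha> n"
    using rep[OF dec[of "K n"], of "\<alpha> (K n) / \<alpha> n" n] rn by simp
  also have "(\<Sum>b\<in>B. representation ?C (K b) b) = (\<Sum>b\<in>B. representation B (L b) b)"
  proof (rule sum.cong[OF refl])
    fix b assume b: "b \<in> B"
    then have ab: "\<alpha> b = 0" using B(3) by auto
    have "b \<noteq> n" using b nT span_base by auto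
    moreover have "K b = L b + (- m b) *\<^sub>R n" using LK[OF ab] by simp
    moreover have "L b \<in> span B" using LT[OF ab] B(2) by simp
    ultimately show "representation ?C (K b) b = representation B (L b) b"
      using rep[of "L b" "- m b" b] by simp
  qed
  also have "\<dots> = trace_on ?T L"
    using trace_on_eq[OF assms(4) _ B(1)] B(2) LT by (simp add: image_subset_iff)
  finally show ?thesis by simp
qed

text \<open>The Gram map \<open>B\<close> is injective by positivity, hence onto in finite
  dimension.\<close>

lemma riesz:
  fixes g :: "'a::euclidean_space \<Rightarrow> 'a \<Rightarrow> real"
  assumes g: "bilinear g" "\<And>v. v \<noteq> 0 \<Longrightarrow> g v v > 0" and \<phi>: "linear \<phi>"
  obtains v where "\<And>w. g v w = \<phi> w"
proof -
  define B where "B v = (\<Sum>b\<in>Basis. g v b *\<^sub>R b)" for v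
  have lB: "linear B"
    unfolding B_def using g(1)
    by (auto simp: linear_iff bilinear_def sum.distrib scaleR_sum_right algebra_simps)
  have Bb: "B v \<bullet> b = g v b" if "b \<in> Basis" for v b
    unfolding B_def using that by (simp add: inner_sum_left inner_Basis if_distrib cong: if_cong)
  have "inj B"
  proof (rule linear_injective_0[OF lB, THEN iffD2], intro allI impI)
    fix v assume "B v = 0"
    then have "g v b = 0" if "b \<in> Basis" for b using Bb[OF that, of v] by simp
    moreover have "g v v = (\<Sum>b\<in>Basis. (v \<bullet> b) * g v b)"
      using linear_sum[of "g v" "\<lambda>b. (v \<bullet> b) *\<^sub>R b" Basis] g(1)
      by (simp add: euclidean_representation bilinear_def linear_cmul)
    ultimately show "v = 0" using g(2)[of v] by fastforce
  qed
  then have "surj B" using linear_injective_imp_surjective[OF lB] by simp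
  then obtain v where v: "B v = (\<Sum>b\<in>Basis. \<phi> b *\<^sub>R b)" by (metis surjD)
  have e: "g v b = \<phi> b" if "b \<in> Basis" for b
    using Bb[OF that, of v] v that by (simp add: inner_sum_left inner_Basis if_distrib cong: if_cong)
  have "g v w = \<phi> w" for w
    using linear_eq_on[of "g v" \<phi> w Basis] g(1) \<phi> e by (simp add: bilinear_def)
  then show ?thesis using that by blast
qed

section \<open>Charts of a Riemannian manifold\<close>

lemma bilinear_expand:
  fixes B :: "'a::euclidean_space \<Rightarrow> 'a \<Rightarrow> real"
  assumes "bilinear B"
  shows "B v w = (\<Sum>b\<in>Basis. \<Sum>c\<in>Basis. (v \<bullet> b) * (w \<bullet> c) * B b c)"
proof -
  have l: "linear (\<lambda>v. B v w)" for w using assms by (simp add: bilinear_def)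
  have r: "linear (B v)" for v using assms by (simp add: bilinear_def)
  have "B v w = (\<Sum>b\<in>Basis. (v \<bullet> b) * B b w)"
    using linear_sum[OF l, of "\<lambda>b. (v \<bullet> b) *\<^sub>R b" Basis w]
    by (simp add: euclidean_representation linear_cmul[OF l])
  also have "\<dots> = (\<Sum>b\<in>Basis. (v \<bullet> b) * (\<Sum>c\<in>Basis. (w \<bullet> c) * B b c))"
  proof (intro sum.cong refl arg_cong2[where f = "(*)"])
    fix b
    show "B b w = (\<Sum>c\<in>Basis. (w \<bullet> c) * B b c)"
      using linear_sum[OF r, of b "\<lambda>c. (w \<bullet> c) *\<^sub>R c" Basis]
      by (simp add: euclidean_representation linear_cmul[OF r])
  qed
  finally show ?thesis by (simp add: sum_distrib_left mult.assoc)
qed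

text \<open>The difference of two solutions, lowered by \<open>g\<close>, is symmetric in its first
  two slots and skew in the last two. Alternating the two symmetries cycles through all orders of
  the slots and returns with the opposite sign, so it vanishes.\<close>

lemma christoffel_unique:
  fixes g :: "'a::euclidean_space \<Rightarrow> 'a \<Rightarrow> real"
  assumes g: "bilinear g" "\<And>v w. g v w = g w v" "\<And>v. v \<noteq> 0 \<Longrightarrow> g v v > 0"
    and G: "\<And>v w. G v w = G w v" "\<And>z v w. d z v w = g (G z v) w + g v (G z w)"
    and H: "\<And>v w. H v w = H w v" "\<And>z v w. d z v w = g (H z v) w + g v (H z w)"
  shows "G = H"
proof (intro ext)
  fix z v
  define A where "A z v w = g (G z v - H z v) w" for z v w
  have s: "A z v w = A v z w" for z v w unfolding A_def using G(1) H(1) by metis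
  have a: "A z v w = - A z w v" for z v w
    unfolding A_def using G(2)[of z v w] H(2)[of z v w] g(2)[of v "G z w"] g(2)[of v "H z w"]
    by (simp add: bilinear_lsub[OF g(1)])
  have "A z v w = 0" for w
    using s[of z v w] s[of v w z] s[of w z v] a[of z v w] a[of v z w] a[of w z v] by linarith
  then have "g (G z v - H z v) (G z v - H z v) = 0" unfolding A_def by simp
  then show "G z v = H z v" using g(3)[of "G z v - H z v"] by fastforce
qed

lemma christoffel_exists:
  fixes g :: "'a::euclidean_space \<Rightarrow> 'a \<Rightarrow> real"
  assumes g: "bilinear g" "\<And>v w. g v w = g w v" "\<And>v. v \<noteq> 0 \<Longrightarrow> g v v > 0"
    and d: "\<And>v w. linear (\<lambda>z. d z v w)" "\<And>z. bilinear (d z)" "\<And>z v w. d z v w = d z w v"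
  obtains G where "bilinear G" "\<And>v w. G v w = G w v"
    "\<And>z v w. d z v w = g (G z v) w + g v (G z w)"
proof -
  \<comment> \<open>Koszul's formula for commuting fields\<close>
  define K where "K z v w = (d z v w + d v z w - d w z v) / 2" for z v w
  have "linear (K z v)" for z v
    using d(1,2) unfolding K_def by (auto simp: linear_iff bilinear_def algebra_simps add_divide_distrib diff_divide_distrib)
  then have "\<exists>u. \<forall>w. g u w = K z v w" for z v
    using riesz[OF g(1,3), of "K z v"] by metis
  then obtain G where G: "\<And>z v w. g (G z v) w = K z v w" by metis
  \<comment> \<open>\<open>G\<close> is known only through its pairings with \<open>g\<close>, so
    its symmetry and linearity are read off \<open>K\<close> by nondegeneracy.\<close>
  have eq: "u = u'" if "\<And>w. g u w = g u' w" for u u'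
    using g(3)[of "u - u'"] that[of "u - u'"] by (fastforce simp: bilinear_lsub[OF g(1)])
  have Kl: "K (z + z') v w = K z v w + K z' v w" "K (r *\<^sub>R z) v w = r * K z v w" for z z' v w r
    using d(1,2) unfolding K_def by (auto simp: linear_iff bilinear_def algebra_simps add_divide_distrib diff_divide_distrib)
  have Ks: "K z v w = K v z w" for z v w using d(3)[of w z v] unfolding K_def by simp
  have sym: "G v w = G w v" for v w by (rule eq) (simp add: G Ks[of v w])
  have l: "linear (\<lambda>z. G z v)" for v
    by (rule linearI; rule eq) (simp_all add: G Kl bilinear_ladd[OF g(1)] bilinear_lmul[OF g(1)])
  have "bilinear G"
    unfolding bilinear_def using l sym[of _] by (metis (no_types, lifting) ext)
  moreover have "d z v w = g (G z v) w + g v (G z w)" for z v w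
    using g(2)[of v "G z w"] d(3)[of z v w] d(3)[of v z w] d(3)[of w z v]
    by (simp add: G K_def field_simps)
  ultimately show ?thesis using that sym by blast
qed

text \<open>What can be said in one chart without transition maps. The product chart satisfies the
  same axioms, so every fact proved here serves both the base and the product.\<close>

locale riemannian_chart =
  fixes c :: "('m::topological_space, 'a::euclidean_space) rchart"
  assumes open_dom: "open (chart_dom c)"
    and open_img: "open (coord c ` chart_dom c)"
    and homeo: "homeomorphism (chart_dom c) (coord c ` chart_dom c)
          (coord c) (inv_into (chart_dom c) (coord c))"
    and metric_smooth: "\<And>v w. smooth_on (coord c ` chart_dom c) (\<lambda>x. metric_tensor c x v w)"
    and metric_bilinear: "\<And>p. p \<in> chart_dom c \<Longrightarrow> bilinear (rinner c p)"
    and metric_sym: "\<And>p v w. p \<in> chart_dom c \<Longrightarrow> rinner c p v w = rinner c p w v"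
    and metric_pos: "\<And>p v. p \<in> chart_dom c \<Longrightarrow> v \<noteq> 0 \<Longrightarrow> rinner c p v v > 0"
begin

lemma inv_coord [simp]: "p \<in> chart_dom c \<Longrightarrow> inv_into (chart_dom c) (coord c) (coord c p) = p"
  using homeo by (simp add: homeomorphism_def)

lemma coord_inj: "p \<in> chart_dom c \<Longrightarrow> q \<in> chart_dom c \<Longrightarrow> coord c p = coord c q \<Longrightarrow> p = q"
  using inv_coord by metis

lemma local_rep_coord [simp]: "p \<in> chart_dom c \<Longrightarrow> local_rep c f (coord c p) = f p"
  by (simp add: local_rep_def)

lemma open_coord_image: "open W \<Longrightarrow> open (coord c ` (W \<inter> chart_dom c))"
proof -
  assume "open W"
  then have "openin (top_of_set (chart_dom c)) (W \<inter> chart_dom c)"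
    using open_dom by (simp add: openin_open_eq open_Int)
  then show ?thesis
    using homeomorphism_imp_open_map[OF homeo] open_img openin_open_eq by blast
qed

lemma continuous_from_local_rep:
  assumes "continuous_on (coord c ` (W \<inter> chart_dom c)) (local_rep c f)"
  shows "continuous_on (W \<inter> chart_dom c) f"
proof -
  have "continuous_on (W \<inter> chart_dom c) (\<lambda>p. local_rep c f (coord c p))"
    using homeo by (intro continuous_on_compose2[OF assms])
      (auto simp: homeomorphism_def intro: continuous_on_subset)
  then show ?thesis by (rule continuous_on_eq) auto
qed

lemma metric_nondegenerate:
  assumes "p \<in> chart_dom c" "\<And>w. rinner c p u w = rinner c p v w"
  shows "u = v"
  using metric_pos[OF assms(1), of "u - v"] assms(2)[of "u - v"]
  by (fastforce simp: bilinear_lsub[OF metric_bilinear[OF assms(1)]])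

abbreviation dmetric :: "'m \<Rightarrow> 'a \<Rightarrow> 'a \<Rightarrow> 'a \<Rightarrow> real" where
  "dmetric p z v w \<equiv> frechet_derivative (\<lambda>x. metric_tensor c x v w) (at (coord c p)) z"

lemma metric_has_derivative:
  "p \<in> chart_dom c \<Longrightarrow> ((\<lambda>x. metric_tensor c x v w) has_derivative (\<lambda>z. dmetric p z v w)) (at (coord c p))"
  using smooth_on_has_derivative[OF metric_smooth open_img, of "coord c p" v w] by simp

text \<open>The algebraic laws of the metric are given only over the image of the chart; as that
  image is open, they still pass to the derivatives of the coefficients.\<close>

lemma dmetric_eqI:
  assumes "p \<in> chart_dom c" "(f has_derivative f') (at (coord c p))"
    and "\<And>q. q \<in> chart_dom c \<Longrightarrow> f (coord c q) = rinner c q v w"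
  shows "dmetric p z v w = f' z"
proof -
  have "((\<lambda>x. metric_tensor c x v w) has_derivative f') (at (coord c p))"
    by (rule has_derivative_transform_within_open[OF assms(2) open_img])
      (use assms(1,3) in \<open>auto simp: rinner_def\<close>)
  then show ?thesis using frechet_derivative_at by metis
qed

lemma dmetric_linear: "p \<in> chart_dom c \<Longrightarrow> linear (\<lambda>z. dmetric p z v w)"
  by (rule has_derivative_linear[OF metric_has_derivative])

lemma dmetric_sym: "p \<in> chart_dom c \<Longrightarrow> dmetric p z v w = dmetric p z w v"
  by (rule dmetric_eqI[OF _ metric_has_derivative]) (auto simp: metric_sym rinner_def[symmetric])

lemma dmetric_bilinear:
  assumes p: "p \<in> chart_dom c"
  shows "bilinear (dmetric p z)"
proof -
  have l: "linear (\<lambda>v. dmetric p z v w)" for w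
  proof (rule linearI)
    fix v v' r
    show "dmetric p z (v + v') w = dmetric p z v w + dmetric p z v' w"
      by (rule dmetric_eqI[OF p has_derivative_add[OF metric_has_derivative[OF p] metric_has_derivative[OF p]]])
        (simp add: rinner_def[symmetric] bilinear_ladd[OF metric_bilinear])
    show "dmetric p z (r *\<^sub>R v) w = r *\<^sub>R dmetric p z v w"
      by (rule dmetric_eqI[OF p has_derivative_scaleR_right[OF metric_has_derivative[OF p]]])
        (simp add: rinner_def[symmetric] bilinear_lmul[OF metric_bilinear])
  qed
  moreover have "dmetric p z v = (\<lambda>w. dmetric p z w v)" for v
    by (rule ext) (rule dmetric_sym[OF p])
  ultimately show ?thesis unfolding bilinear_def by simp
qed

lemma levi_civita_eqI:
  assumes p: "p \<in> chart_dom c" and G: "bilinear G" "\<And>v w. G v w = G w v"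
    "\<And>z v w. dmetric p z v w = rinner c p (G z v) w + rinner c p v (G z w)"
  shows "levi_civita c p = G"
  unfolding levi_civita_def
proof (rule the_equality)
  show "bilinear G \<and> (\<forall>v w. G v w = G w v) \<and>
    (\<forall>z v w. dmetric p z v w = rinner c p (G z v) w + rinner c p v (G z w))"
    using G by blast
  fix H assume H: "bilinear H \<and> (\<forall>v w. H v w = H w v) \<and>
    (\<forall>z v w. dmetric p z v w = rinner c p (H z v) w + rinner c p v (H z w))"
  show "H = G"
    by (rule christoffel_unique[OF metric_bilinear[OF p] metric_sym[OF p] metric_pos[OF p], where d = "dmetric p"])
      (use G H in blast)+
qed

lemma
  assumes p: "p \<in> chart_dom c"
  shows levi_civita_bilinear: "bilinear (levi_civita c p)"
    and levi_civita_sym: "levi_civita c p v w = levi_civita c p w v"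
    and levi_civita_compat:
      "dmetric p z v w = rinner c p (levi_civita c p z v) w + rinner c p v (levi_civita c p z w)"
proof -
  obtain G where G: "bilinear G" "\<And>v w. G v w = G w v"
    "\<And>z v w. dmetric p z v w = rinner c p (G z v) w + rinner c p v (G z w)"
    by (rule christoffel_exists[OF metric_bilinear[OF p] metric_sym[OF p] metric_pos[OF p]
          dmetric_linear[OF p] dmetric_bilinear[OF p] dmetric_sym[OF p]]) auto
  then have "levi_civita c p = G" using levi_civita_eqI[OF p] by blast
  then show "bilinear (levi_civita c p)" "levi_civita c p v w = levi_civita c p w v"
    "dmetric p z v w = rinner c p (levi_civita c p z v) w + rinner c p v (levi_civita c p z w)"
    using G by auto
qed

text \<open>Extends compatibility with the metric from constant to moving vectors. Smoothness of the
  metric tensor is given for fixed vectors only, so the inner product is first expanded over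
  \<open>Basis\<close>; \<open>levi_civita_compat\<close> then absorbs the derivative of the
  coefficients.\<close>

lemma metric_leibniz:
  fixes F G h :: "'b::real_normed_vector \<Rightarrow> 'a"
  assumes p: "p \<in> chart_dom c" and h: "(h has_derivative h') (at s)" "h s = coord c p"
    and F: "(F has_derivative F') (at s)" and G: "(G has_derivative G') (at s)"
  shows "((\<lambda>s. metric_tensor c (h s) (F s) (G s)) has_derivative
    (\<lambda>z. rinner c p (F' z + levi_civita c p (h' z) (F s)) (G s) +
         rinner c p (F s) (G' z + levi_civita c p (h' z) (G s)))) (at s)"
proof -
  let ?E = "\<lambda>s. \<Sum>b\<in>Basis. \<Sum>d\<in>Basis. (F s \<bullet> b) * (G s \<bullet> d) * metric_tensor c (h s) b d"
  let ?E' = "\<lambda>z. \<Sum>b\<in>Basis. \<Sum>d\<in>Basis. (F s \<bullet> b) * (G s \<bullet> d) * dmetric p (h' z) b d +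
      ((F s \<bullet> b) * (G' z \<bullet> d) + (F' z \<bullet> b) * (G s \<bullet> d)) * metric_tensor c (h s) b d"
  have m: "((\<lambda>s. metric_tensor c (h s) b d) has_derivative (\<lambda>z. dmetric p (h' z) b d)) (at s)" for b d
    using has_derivative_compose[OF h(1) metric_has_derivative[OF p, of b d, folded h(2)]]
    unfolding h(2) .
  have E: "(?E has_derivative ?E') (at s)"
    by (intro has_derivative_sum has_derivative_mult m has_derivative_inner_left F G)
  \<comment> \<open>Bilinearity, and with it the expansion, is available only while \<open>h\<close>
    stays in the image of the chart.\<close>
  have near: "\<forall>\<^sub>F y in at s. h y \<in> coord c ` chart_dom c"
    using has_derivative_continuous[OF h(1)] open_img h(2) p
    unfolding continuous_within by (intro topological_tendstoD) auto
  have ex: "metric_tensor c (h y) (F y) (G y) = ?E y" if "h y \<in> coord c ` chart_dom c" for y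
    using that bilinear_expand[OF metric_bilinear] by (auto simp: rinner_def)
  have "((\<lambda>s. metric_tensor c (h s) (F s) (G s)) has_derivative ?E') (at s)"
  proof (rule has_derivative_transform_eventually[OF E])
    show "\<forall>\<^sub>F y in at s. ?E y = metric_tensor c (h y) (F y) (G y)"
      by (rule eventually_mono[OF near]) (rule ex[symmetric])
    show "?E s = metric_tensor c (h s) (F s) (G s)"
      by (rule ex[symmetric]) (use h(2) p in simp)
  qed simp
  moreover have "?E' z = rinner c p (F' z + levi_civita c p (h' z) (F s)) (G s) +
         rinner c p (F s) (G' z + levi_civita c p (h' z) (G s))" for z
  proof -
    note B = metric_bilinear[OF p]
    have ED: "dmetric p (h' z) (F s) (G s) =
        (\<Sum>b\<in>Basis. \<Sum>d\<in>Basis. (F s \<bullet> b) * (G s \<bullet> d) * dmetric p (h' z) b d)"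
      by (rule bilinear_expand[OF dmetric_bilinear[OF p]])
    have "?E' z = dmetric p (h' z) (F s) (G s) + (rinner c p (F s) (G' z) + rinner c p (F' z) (G s))"
      unfolding ED
        bilinear_expand[OF B, of "F s"] bilinear_expand[OF B, of "F' z"]
      by (simp add: h(2) rinner_def sum.distrib[symmetric] algebra_simps)
    then show ?thesis
      by (simp add: levi_civita_compat[OF p] bilinear_ladd[OF B] bilinear_radd[OF B])
  qed
  ultimately show ?thesis by simp
qed

lemma metric_field_smooth:
  assumes "open V" "V \<subseteq> coord c ` chart_dom c" "smooth_on V F" "smooth_on V G"
  shows "smooth_on V (\<lambda>x. metric_tensor c x (F x) (G x))"
proof (rule smooth_on_cong[OF assms(1)])
  show "smooth_on V (\<lambda>x. \<Sum>b\<in>Basis. \<Sum>d\<in>Basis. (F x \<bullet> b) *\<^sub>R (G x \<bullet> d) *\<^sub>R metric_tensor c x b d)"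
    by (intro smooth_on_sum smooth_on_scaleR assms smooth_on_linear_compose[OF bounded_linear_inner_left]
        smooth_on_subset[OF metric_smooth assms(2)])
  show "(\<Sum>b\<in>Basis. \<Sum>d\<in>Basis. (F x \<bullet> b) *\<^sub>R (G x \<bullet> d) *\<^sub>R metric_tensor c x b d)
      = metric_tensor c x (F x) (G x)" if "x \<in> V" for x
  proof -
    have "x \<in> coord c ` chart_dom c" using assms(2) that by blast
    then obtain p where "x = coord c p" "p \<in> chart_dom c" by (rule imageE)
    then show ?thesis
      using bilinear_expand[OF metric_bilinear, of p "F x" "G x"] by (simp add: rinner_def mult.assoc)
  qed
qed

section \<open>Tangent spaces, derivatives along subsets, gradients\<close>

lemma tangent_spaceI:
  assumes "e > 0" "smooth_on {-e<..<e} \<gamma>" "\<And>s. s \<in> {-e<..<e} \<Longrightarrow> \<gamma> s \<in> coord c ` (S \<inter> chart_dom c)"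
    "\<gamma> 0 = coord c p" "(\<gamma> has_vector_derivative v) (at (0::real))"
  shows "v \<in> tangent_space c S p"
  using assms unfolding tangent_space_def by blast

lemma tangent_space_open:
  assumes "open W" "p \<in> W \<inter> chart_dom c"
  shows "tangent_space c W p = UNIV"
proof (intro equalityI subset_UNIV subsetI)
  fix v :: 'a
  let ?\<gamma> = "\<lambda>s. coord c p + s *\<^sub>R v"
  have "open (?\<gamma> -` (coord c ` (W \<inter> chart_dom c)))"
    by (intro open_vimage open_coord_image assms(1) continuous_intros)
  moreover have "0 \<in> ?\<gamma> -` (coord c ` (W \<inter> chart_dom c))" using assms(2) by simp
  ultimately obtain e where e: "e > 0" "ball 0 e \<subseteq> ?\<gamma> -` (coord c ` (W \<inter> chart_dom c))"
    using open_contains_ball by blast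
  show "v \<in> tangent_space c W p"
  proof (rule tangent_spaceI[OF e(1)])
    show "smooth_on {-e<..<e} ?\<gamma>"
      by (intro smooth_on_add smooth_on_const smooth_on_bounded_linear bounded_linear_scaleR_left) auto
    show "?\<gamma> s \<in> coord c ` (W \<inter> chart_dom c)" if "s \<in> {-e<..<e}" for s
    proof -
      have "s \<in> ball 0 e" using that by (auto simp: dist_real_def)
      then show ?thesis using e(2) by blast
    qed
    show "(?\<gamma> has_vector_derivative v) (at 0)" by (auto intro!: derivative_eq_intros)
  qed simp
qed

text \<open>A derivative within \<open>S\<close> is in general not unique, and
  \<open>deriv_along\<close> picks one. Composing any candidate with a curve in \<open>S\<close>
  yields a derivative in one real variable, which is unique, so all candidates agree on velocities
  of such curves. Whatever the choice, it is linear on the whole model space, as the trace lemmas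
  require.\<close>

lemma
  assumes p: "p \<in> S \<inter> chart_dom c" and V: "open V" "coord c p \<in> V"
    and F: "(F has_derivative F') (at (coord c p))"
    and eq: "\<And>q. q \<in> S \<inter> chart_dom c \<Longrightarrow> coord c q \<in> V \<Longrightarrow> F (coord c q) = f q"
  shows deriv_along_eq: "v \<in> tangent_space c S p \<Longrightarrow> deriv_along c S f p v = F' v"
    and deriv_along_linear: "linear (deriv_along c S f p)"
proof -
  let ?S = "coord c ` (S \<inter> chart_dom c)"
  have within: "(local_rep c f has_derivative F') (at (coord c p) within ?S)"
  proof -
    obtain d where d: "d > 0" "ball (coord c p) d \<subseteq> V" using V open_contains_ball by blast
    show ?thesis
    proof (rule has_derivative_transform_within[OF has_derivative_at_withinI[OF F] d(1)])
      show "coord c p \<in> ?S" using p by blast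
      show "F x = local_rep c f x" if "x \<in> ?S" "dist x (coord c p) < d" for x
        using that d(2) eq by (auto simp: dist_commute subset_iff)
    qed
  qed
  then have D: "(local_rep c f has_derivative deriv_along c S f p) (at (coord c p) within ?S)"
    unfolding deriv_along_def using frechet_derivative_works differentiable_def by blast
  then show "linear (deriv_along c S f p)" by (rule has_derivative_linear)
  assume "v \<in> tangent_space c S p"
  then obtain \<gamma> e where \<gamma>: "e > 0" "\<gamma> ` {-e<..<e} \<subseteq> ?S" "\<gamma> 0 = coord c p"
    "(\<gamma> has_derivative (\<lambda>h. h *\<^sub>R v)) (at (0::real))"
    unfolding tangent_space_def has_vector_derivative_def by blast
  have 0: "0 \<in> {-e<..<e}" using \<gamma>(1) by simp
  have chain: "((\<lambda>s. local_rep c f (\<gamma> s)) has_derivative (\<lambda>h. E (h *\<^sub>R v))) (at 0)"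
    if "(local_rep c f has_derivative E) (at (coord c p) within ?S)" for E
  proof -
    have "(local_rep c f has_derivative E) (at (\<gamma> 0) within \<gamma> ` {-e<..<e})"
      using has_derivative_subset[OF that \<gamma>(2)] \<gamma>(3) by simp
    then have "((\<lambda>s. local_rep c f (\<gamma> s)) has_derivative (\<lambda>h. E (h *\<^sub>R v))) (at 0 within {-e<..<e})"
      by (rule has_derivative_in_compose[OF has_derivative_at_withinI[OF \<gamma>(4)]])
    then show ?thesis unfolding at_within_open[OF 0 open_greaterThanLessThan] .
  qed
  have "(\<lambda>h. deriv_along c S f p (h *\<^sub>R v)) = (\<lambda>h. F' (h *\<^sub>R v))"
    by (rule has_derivative_unique[OF chain[OF D] chain[OF within]])
  from fun_cong[OF this, of 1] show "deriv_along c S f p v = F' v" by simp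
qed

lemma grad_eqI:
  assumes p: "p \<in> chart_dom c" and T: "subspace (tangent_space c S p)"
    and v: "v \<in> tangent_space c S p"
    "\<And>w. w \<in> tangent_space c S p \<Longrightarrow> rinner c p v w = deriv_along c S f p w"
  shows "grad c S f p = v"
  unfolding grad_def
proof (rule the_equality)
  show "v \<in> tangent_space c S p \<and> (\<forall>w\<in>tangent_space c S p. rinner c p v w = deriv_along c S f p w)"
    using v by blast
  fix u assume u: "u \<in> tangent_space c S p \<and> (\<forall>w\<in>tangent_space c S p. rinner c p u w = deriv_along c S f p w)"
  then have "u - v \<in> tangent_space c S p" using v T subspace_diff by blast
  then have "rinner c p (u - v) (u - v) = 0"
    using u v(2) by (simp add: bilinear_lsub[OF metric_bilinear[OF p]])
  then show "u = v" using metric_pos[OF p, of "u - v"] by fastforce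
qed

lemma rinner_grad_open:
  assumes "open W" "p \<in> W \<inter> chart_dom c" "(local_rep c f has_derivative F') (at (coord c p))"
  shows "rinner c p (grad c W f p) w = F' w"
proof -
  have p: "p \<in> chart_dom c" using assms(2) by auto
  have T: "tangent_space c W p = UNIV" using tangent_space_open assms by blast
  have D: "deriv_along c W f p w = F' w" for w
    by (rule deriv_along_eq[OF assms(2) open_UNIV _ assms(3)]) (auto simp: T)
  obtain v where v: "\<And>w. rinner c p v w = F' w"
    using riesz[OF metric_bilinear[OF p] metric_pos[OF p] has_derivative_linear[OF assms(3)]] by metis
  have "grad c W f p = v" by (rule grad_eqI[OF p]) (auto simp: T v D)
  then show ?thesis using v by simp
qed

end

section \<open>Graphs of functions\<close>

lemma prod_line_chart_sel [simp]:
  "chart_dom (prod_line_chart c) = chart_dom c \<times> UNIV"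
  "coord (prod_line_chart c) (p, t) = (coord c p, t)"
  "metric_tensor (prod_line_chart c) (x, s) (v, a) (w, b) = metric_tensor c x v w + a * b"
  "rinner (prod_line_chart c) (p, t) (v, a) (w, b) = rinner c p v w + a * b"
  by (simp_all add: prod_line_chart_def rinner_def)

lemma coord_prod_image [simp]:
  "coord (prod_line_chart c) ` (chart_dom c \<times> UNIV) = (coord c ` chart_dom c) \<times> UNIV"
  by (force simp: image_iff)

lemma (in riemannian_chart) riemannian_chart_prod: "riemannian_chart (prod_line_chart c)"
proof
  let ?P = "prod_line_chart c"
  show "open (chart_dom ?P)" "open (coord ?P ` chart_dom ?P)"
    using open_dom open_img by (auto intro: open_Times)
  show "homeomorphism (chart_dom ?P) (coord ?P ` chart_dom ?P) (coord ?P) (inv_into (chart_dom ?P) (coord ?P))"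
  proof -
    have inj: "inj_on (coord ?P) (chart_dom ?P)"
      using coord_inj by (auto simp: inj_on_def)
    have i: "inv_into (chart_dom ?P) (coord ?P) z = (inv_into (chart_dom c) (coord c) (fst z), snd z)"
      if "z \<in> coord ?P ` chart_dom ?P" for z
      using that by (intro inv_into_f_eq[OF inj]) auto
    have 1: "continuous_on (chart_dom ?P) (coord ?P)"
    proof (rule continuous_on_eq)
      show "continuous_on (chart_dom ?P) (\<lambda>z. (coord c (fst z), snd z))"
        using homeo unfolding homeomorphism_def
        by (intro continuous_intros continuous_on_compose2[of "chart_dom c" "coord c" _ fst]) auto
    qed auto
    have 2: "continuous_on (coord ?P ` chart_dom ?P) (inv_into (chart_dom ?P) (coord ?P))"
    proof (rule continuous_on_eq)
      show "continuous_on (coord ?P ` chart_dom ?P) (\<lambda>z. (inv_into (chart_dom c) (coord c) (fst z), snd z))"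
        using homeo unfolding homeomorphism_def
        by (intro continuous_intros
            continuous_on_compose2[of "coord c ` chart_dom c" "inv_into (chart_dom c) (coord c)" _ fst]) auto
    qed (use i in auto)
    show ?thesis
      unfolding homeomorphism_def
      using 1 2 inv_into_f_f[OF inj] inv_into_image_cancel[OF inj order_refl] f_inv_into_f[of _ "coord ?P" "chart_dom ?P"]
      by blast
  qed
  show "smooth_on (coord ?P ` chart_dom ?P) (\<lambda>x. metric_tensor ?P x v w)" for v w
  proof -
    have o: "open (coord ?P ` chart_dom ?P)" using open_img by (auto intro: open_Times)
    have "smooth_on (coord ?P ` chart_dom ?P) (\<lambda>x. metric_tensor c (fst x) (fst v) (fst w) + snd v * snd w)"
      by (rule smooth_on_add[OF o smooth_on_compose[OF o open_img _ smooth_on_bounded_linear[OF bounded_linear_fst o] metric_smooth] smooth_on_const])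
        auto
    then show ?thesis
      by (rule smooth_on_cong[OF o, rotated]) (cases v; cases w; auto)
  qed
  fix z assume z: "z \<in> chart_dom ?P"
  then obtain p t where p: "z = (p, t)" "p \<in> chart_dom c" by auto
  note B = metric_bilinear[OF p(2)]
  show "bilinear (rinner ?P z)"
    unfolding bilinear_def linear_iff p
    by (auto simp: bilinear_ladd[OF B] bilinear_radd[OF B] bilinear_lmul[OF B] bilinear_rmul[OF B] algebra_simps)
  show "rinner ?P z v w = rinner ?P z w v" for v w
    using metric_sym[OF p(2)] by (cases v; cases w) (simp add: p(1) mult.commute)
  show "rinner ?P z v v > 0" if "v \<noteq> 0" for v
  proof (cases v)
    case (Pair a b)
    have "rinner c p a a \<ge> 0"
      using metric_pos[OF p(2), of a] bilinear_lzero[OF B] by (cases "a = 0") auto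
    moreover have "rinner c p a a > 0 \<or> b * b > 0"
      using that metric_pos[OF p(2), of a] by (auto simp: Pair zero_prod_def not_real_square_gt_zero)
    ultimately show ?thesis by (auto simp: p(1) Pair intro: add_pos_nonneg add_nonneg_pos)
  qed
qed

text \<open>\<open>W\<close> is the fixed domain over which the gradient of \<open>u\<close> is
  formed; graphs and level sets are considered over open subsets \<open>U\<close> of it.\<close>

locale chart_function = riemannian_chart c
  for c :: "('m::topological_space, 'a::euclidean_space) rchart" +
  fixes W :: "'m set" and u :: "'m \<Rightarrow> real"
  assumes open_W: "open W"
    and smooth_u: "smooth_on (coord c ` (W \<inter> chart_dom c)) (local_rep c u)"
begin

sublocale prod: riemannian_chart "prod_line_chart c"
  by (rule riemannian_chart_prod)

text \<open>The coefficients of the product metric do not depend on the height and its vertical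
  block is constant, so the vertical direction adds nothing to the Christoffel tensor. The guess is
  verified against the unique characterisation.\<close>

lemma levi_civita_prod:
  assumes p: "p \<in> chart_dom c"
  shows "levi_civita (prod_line_chart c) (p, t) = (\<lambda>v w. (levi_civita c p (fst v) (fst w), 0))"
proof (rule prod.levi_civita_eqI)
  let ?G = "\<lambda>v w :: 'a \<times> real. (levi_civita c p (fst v) (fst w), 0 :: real)"
  note B = levi_civita_bilinear[OF p]
  show "bilinear ?G"
    unfolding bilinear_def linear_iff
    by (auto simp: bilinear_ladd[OF B] bilinear_radd[OF B] bilinear_lmul[OF B] bilinear_rmul[OF B])
  show "?G v w = ?G w v" for v w by (simp add: levi_civita_sym[OF p])
  fix z v w :: "'a \<times> real"
  have "prod.dmetric (p, t) z v w = dmetric p (fst z) (fst v) (fst w) + 0"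
  proof (rule prod.dmetric_eqI)
    show "((\<lambda>x. metric_tensor c (fst x) (fst v) (fst w) + snd v * snd w) has_derivative
      (\<lambda>z. dmetric p (fst z) (fst v) (fst w) + 0)) (at (coord (prod_line_chart c) (p, t)))"
      by (intro has_derivative_add has_derivative_const
          has_derivative_compose[OF has_derivative_fst[OF has_derivative_ident]])
        (simp add: metric_has_derivative[OF p])
    show "metric_tensor c (fst (coord (prod_line_chart c) q)) (fst v) (fst w) + snd v * snd w
      = rinner (prod_line_chart c) q v w" for q
      by (cases q; cases v; cases w) (simp add: rinner_def)
  qed (simp add: p)
  also have "\<dots> = rinner (prod_line_chart c) (p, t) (?G z v) w + rinner (prod_line_chart c) (p, t) v (?G z w)"
    by (cases v; cases w) (simp add: levi_civita_compat[OF p])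
  finally show "prod.dmetric (p, t) z v w = \<dots>" .
qed (simp add: p)

definition du :: "'m \<Rightarrow> 'a \<Rightarrow> real" where
  "du p = frechet_derivative (local_rep c u) (at (coord c p))"

lemma du_has_derivative: "p \<in> W \<inter> chart_dom c \<Longrightarrow> (local_rep c u has_derivative du p) (at (coord c p))"
  unfolding du_def by (rule smooth_on_has_derivative[OF smooth_u open_coord_image[OF open_W]]) blast

lemma du_linear: "p \<in> W \<inter> chart_dom c \<Longrightarrow> linear (du p)"
  using du_has_derivative has_derivative_linear by blast

lemma rinner_grad: "p \<in> W \<inter> chart_dom c \<Longrightarrow> rinner c p (grad c W u p) w = du p w"
  by (rule rinner_grad_open[OF open_W _ du_has_derivative])

lemma rinner_grad': "p \<in> W \<inter> chart_dom c \<Longrightarrow> rinner c p w (grad c W u p) = du p w"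
  using rinner_grad metric_sym by (metis IntD2)

lemma continuous_u: "continuous_on (W \<inter> chart_dom c) u"
  by (rule continuous_from_local_rep[OF smooth_on_continuous[OF smooth_u]])

lemma coord_graph_image:
  "z \<in> coord (prod_line_chart c) ` (graph_on U u \<inter> chart_dom (prod_line_chart c))
    \<longleftrightarrow> fst z \<in> coord c ` (U \<inter> chart_dom c) \<and> snd z = local_rep c u (fst z)"
  by (cases z) (force simp: graph_on_def)

text \<open>One inclusion differentiates the relation between height and base point along a curve in
  the graph; the other lifts a curve of the base by \<open>u\<close>.\<close>

lemma tangent_space_graph:
  assumes U: "open U" "U \<subseteq> W" and p: "p \<in> U \<inter> chart_dom c"
  shows "tangent_space (prod_line_chart c) (graph_on U u) (p, u p) = range (\<lambda>v. (v, du p v))"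
proof (intro equalityI subsetI)
  let ?P = "prod_line_chart c" and ?x = "coord c p"
  have pW: "p \<in> W \<inter> chart_dom c" using U p by auto
  fix w assume "w \<in> tangent_space ?P (graph_on U u) (p, u p)"
  then obtain \<gamma> e where \<gamma>: "e > 0" "\<gamma> ` {-e<..<e} \<subseteq> coord ?P ` (graph_on U u \<inter> chart_dom ?P)"
    "\<gamma> 0 = coord ?P (p, u p)" "(\<gamma> has_derivative (\<lambda>h. h *\<^sub>R w)) (at (0::real))"
    unfolding tangent_space_def has_vector_derivative_def by blast
  have \<gamma>0: "fst (\<gamma> 0) = ?x" using \<gamma>(3) by simp
  have d: "((\<lambda>s. local_rep c u (fst (\<gamma> s))) has_derivative (\<lambda>h. du p (fst (h *\<^sub>R w)))) (at 0)"
    by (rule has_derivative_compose[OF has_derivative_fst[OF \<gamma>(4)]]) (simp add: \<gamma>0 du_has_derivative[OF pW])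
  have "((\<lambda>s. snd (\<gamma> s)) has_derivative (\<lambda>h. du p (fst (h *\<^sub>R w)))) (at 0)"
  proof (rule has_derivative_transform_within_open[OF d])
    show "local_rep c u (fst (\<gamma> s)) = snd (\<gamma> s)" if "s \<in> {-e<..<e}" for s
    proof -
      have "\<gamma> s \<in> coord ?P ` (graph_on U u \<inter> chart_dom ?P)" using \<gamma>(2) that by blast
      then show ?thesis unfolding coord_graph_image by simp
    qed
  qed (use \<gamma>(1) in auto)
  from fun_cong[OF has_derivative_unique[OF this has_derivative_snd[OF \<gamma>(4)]], of 1]
  show "w \<in> range (\<lambda>v. (v, du p v))" by (cases w) auto
next
  let ?P = "prod_line_chart c" and ?x = "coord c p"
  have pW: "p \<in> W \<inter> chart_dom c" using U p by auto
  fix w assume "w \<in> range (\<lambda>v. (v, du p v))"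
  then obtain v where w: "w = (v, du p v)" by blast
  have "v \<in> tangent_space c U p" using tangent_space_open[OF U(1) p] by simp
  then obtain \<gamma> e where \<gamma>: "e > 0" "smooth_on {-e<..<e} \<gamma>" "\<gamma> ` {-e<..<e} \<subseteq> coord c ` (U \<inter> chart_dom c)"
    "\<gamma> 0 = ?x" "(\<gamma> has_derivative (\<lambda>h. h *\<^sub>R v)) (at (0::real))"
    unfolding tangent_space_def has_vector_derivative_def by blast
  let ?\<beta> = "\<lambda>s. (\<gamma> s, local_rep c u (\<gamma> s))"
  show "w \<in> tangent_space ?P (graph_on U u) (p, u p)"
  proof (rule prod.tangent_spaceI[OF \<gamma>(1)])
    have "coord c ` (U \<inter> chart_dom c) \<subseteq> coord c ` (W \<inter> chart_dom c)" using U(2) by blast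
    then have "smooth_on (coord c ` (U \<inter> chart_dom c)) (local_rep c u)"
      using smooth_on_subset[OF smooth_u] by blast
    then show "smooth_on {-e<..<e} ?\<beta>"
      by (intro smooth_on_Pair \<gamma>(2) smooth_on_compose[OF _ open_coord_image[OF U(1)] \<gamma>(3,2)]) auto
    show "?\<beta> s \<in> coord ?P ` (graph_on U u \<inter> chart_dom ?P)" if "s \<in> {-e<..<e}" for s
      unfolding coord_graph_image using \<gamma>(3) that by auto
    show "?\<beta> 0 = coord ?P (p, u p)" using p \<gamma>(4) by simp
    have "((\<lambda>s. local_rep c u (\<gamma> s)) has_derivative (\<lambda>h. du p (h *\<^sub>R v))) (at 0)"
      by (rule has_derivative_compose[OF \<gamma>(5)]) (simp add: \<gamma>(4) du_has_derivative[OF pW])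
    from has_derivative_Pair[OF \<gamma>(5) this] show "(?\<beta> has_vector_derivative w) (at 0)"
      by (simp add: has_vector_derivative_def w linear_cmul[OF du_linear[OF pW]])
  qed
qed

lemma subspace_graph: "p \<in> W \<inter> chart_dom c \<Longrightarrow> subspace (range (\<lambda>v. (v, du p v)))"
proof -
  assume p: "p \<in> W \<inter> chart_dom c"
  have "linear (\<lambda>v. (v, du p v))"
    using du_linear[OF p] by (auto simp: linear_iff)
  then show ?thesis by (rule linear_subspace_image) auto
qed

text \<open>The only part of \<^const>\<open>unit_normal_field\<close> along the graph that is visible in one chart.\<close>

definition graph_normal :: "'m set \<Rightarrow> ('m \<times> real \<Rightarrow> 'a \<times> real) \<Rightarrow> bool" where
  "graph_normal U N \<longleftrightarrow> (\<forall>p\<in>U \<inter> chart_dom c.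
     rinner (prod_line_chart c) (p, u p) (N (p, u p)) (N (p, u p)) = 1 \<and>
     (\<forall>v. rinner (prod_line_chart c) (p, u p) (N (p, u p)) (v, du p v) = 0) \<and>
     (\<exists>V F. open V \<and> (coord c p, u p) \<in> V \<and> smooth_on V F \<and>
        (\<forall>q\<in>U \<inter> chart_dom c. (coord c q, u q) \<in> V \<longrightarrow> F (coord c q, u q) = N (q, u q))))"

text \<open>\<open>l\<close> is the value of the angle function. Orthogonality to all
  \<open>(v, du p v)\<close> determines the horizontal part by nondegeneracy, and unit length gives
  the second identity.\<close>

lemma graph_normal_eq:
  assumes N: "graph_normal U N" and U: "U \<subseteq> W" and p: "p \<in> U \<inter> chart_dom c"
  defines "l \<equiv> snd (N (p, u p))"
  shows "N (p, u p) = (- l *\<^sub>R grad c W u p, l)"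
    and "l\<^sup>2 * (1 + rinner c p (grad c W u p) (grad c W u p)) = 1"
proof -
  let ?n = "grad c W u p" and ?e = "fst (N (p, u p))"
  have pW: "p \<in> W \<inter> chart_dom c" and pc: "p \<in> chart_dom c" using U p by auto
  note B = metric_bilinear[OF pc]
  have Np: "N (p, u p) = (?e, l)" by (simp add: l_def)
  have "rinner (prod_line_chart c) (p, u p) (?e, l) (v, du p v) = 0" for v
    using N p unfolding graph_normal_def Np[symmetric] by blast
  then have "rinner c p ?e v = rinner c p (- l *\<^sub>R ?n) v" for v
    using rinner_grad[OF pW, of v] by (simp add: bilinear_lneg[OF B] bilinear_lmul[OF B] eq_neg_iff_add_eq_0)
  then have e: "?e = - l *\<^sub>R ?n" by (rule metric_nondegenerate[OF pc])
  then show "N (p, u p) = (- l *\<^sub>R ?n, l)" using Np by simp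
  have "rinner (prod_line_chart c) (p, u p) (?e, l) (?e, l) = 1"
    using N p unfolding graph_normal_def Np[symmetric] by blast
  then show "l\<^sup>2 * (1 + rinner c p ?n ?n) = 1"
    unfolding e by (simp add: bilinear_lneg[OF B] bilinear_lmul[OF B] bilinear_rneg[OF B] bilinear_rmul[OF B]
        power2_eq_square algebra_simps)
qed

text \<open>Pulls the ambient extension of the normal back along the graph, so that on the open set
  \<open>X\<close> of chart coordinates the normal can be differentiated in the ordinary sense.
  \<open>F\<close> and \<open>F'\<close> themselves are kept for \<open>deriv_along\<close> in the
  product chart.\<close>

lemma graph_normal_extension:
  assumes N: "graph_normal U N" and U: "open U" "U \<subseteq> W" and p: "p \<in> U \<inter> chart_dom c"
  obtains V F F' X where "open V" "(coord c p, u p) \<in> V" "(F has_derivative F') (at (coord c p, u p))"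
    "\<And>q. q \<in> U \<inter> chart_dom c \<Longrightarrow> (coord c q, u q) \<in> V \<Longrightarrow> F (coord c q, u q) = N (q, u q)"
    "((\<lambda>x. F (x, local_rep c u x)) has_derivative (\<lambda>v. F' (v, du p v))) (at (coord c p))"
    "open X" "coord c p \<in> X"
    "\<And>x. x \<in> X \<Longrightarrow> \<exists>q\<in>U \<inter> chart_dom c. x = coord c q \<and> F (x, local_rep c u x) = N (q, u q)"
proof -
  have pW: "p \<in> W \<inter> chart_dom c" and pc: "p \<in> chart_dom c" using U p by auto
  obtain V F where VF: "open V" "(coord c p, u p) \<in> V" "smooth_on V F"
    "\<And>q. q \<in> U \<inter> chart_dom c \<Longrightarrow> (coord c q, u q) \<in> V \<Longrightarrow> F (coord c q, u q) = N (q, u q)"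
    using N p unfolding graph_normal_def by metis
  obtain F' where F': "(F has_derivative F') (at (coord c p, u p))"
    using smooth_on_has_derivative[OF VF(3,1,2)] by blast
  have dg: "((\<lambda>x. (x, local_rep c u x)) has_derivative (\<lambda>v. (v, du p v))) (at (coord c p))"
    by (intro has_derivative_Pair has_derivative_ident du_has_derivative[OF pW])
  have F1: "((\<lambda>x. F (x, local_rep c u x)) has_derivative (\<lambda>v. F' (v, du p v))) (at (coord c p))"
    by (rule has_derivative_compose[OF dg]) (use F' pc in simp)
  let ?U = "coord c ` (U \<inter> chart_dom c)"
  define X where "X = ?U \<inter> (\<lambda>x. (x, local_rep c u x)) -` V"
  have "?U \<subseteq> coord c ` (W \<inter> chart_dom c)" using U(2) by blast
  then have "continuous_on ?U (local_rep c u)"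
    by (rule continuous_on_subset[OF smooth_on_continuous[OF smooth_u]])
  then have "continuous_on ?U (\<lambda>x. (x, local_rep c u x))"
    by (intro continuous_intros)
  then have "open X"
    unfolding X_def Int_commute[of ?U] using open_coord_image[OF U(1)] VF(1) continuous_on_open_vimage by blast
  moreover have "coord c p \<in> X" using p VF(2) unfolding X_def by auto
  moreover have "\<exists>q\<in>U \<inter> chart_dom c. x = coord c q \<and> F (x, local_rep c u x) = N (q, u q)" if "x \<in> X" for x
    using that VF(4) unfolding X_def by auto
  ultimately show ?thesis using that VF(1,2,4) F' F1 by blast
qed

text \<open>The gradient is read off the normal, which avoids inverting the metric with smooth dependence.\<close>

lemma grad_differentiable:
  assumes N: "graph_normal U N" and U: "open U" "U \<subseteq> W" and p: "p \<in> U \<inter> chart_dom c"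
  shows "local_rep c (grad c W u) differentiable (at (coord c p))"
proof -
  obtain F F' X where X: "((\<lambda>x. F (x, local_rep c u x)) has_derivative (\<lambda>v. F' (v, du p v))) (at (coord c p))"
    "open X" "coord c p \<in> X"
    "\<And>x. x \<in> X \<Longrightarrow> \<exists>q\<in>U \<inter> chart_dom c. x = coord c q \<and> F (x, local_rep c u x) = N (q, u q)"
    by (rule graph_normal_extension[OF N U p]) blast
  let ?l = "\<lambda>x. snd (F (x, local_rep c u x))" and ?f = "\<lambda>x. fst (F (x, local_rep c u x))"
  have eq: "?l x \<noteq> 0 \<and> (- inverse (?l x)) *\<^sub>R ?f x = local_rep c (grad c W u) x" if x: "x \<in> X" for x
  proof -
    obtain q where q: "q \<in> U \<inter> chart_dom c" "x = coord c q" "F (x, local_rep c u x) = N (q, u q)"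
      using X(4)[OF x] by blast
    have l: "?l x \<noteq> 0" using graph_normal_eq(2)[OF N U(2) q(1)] q(3) by auto
    have "?f x = - ?l x *\<^sub>R grad c W u q"
      using arg_cong[OF graph_normal_eq(1)[OF N U(2) q(1)], of fst] q(3) by simp
    then show ?thesis using l q by simp
  qed
  have "((\<lambda>x. (- inverse (?l x)) *\<^sub>R ?f x) differentiable (at (coord c p)))"
    using eq[OF X(3)] differentiableI[OF has_derivative_fst[OF X(1)]] differentiableI[OF has_derivative_snd[OF X(1)]]
    by (intro differentiable_scaleR differentiable_minus differentiable_inverse) auto
  then show ?thesis
    using X(2,3) eq has_derivative_transform_within_open unfolding differentiable_def by blast
qed

end

section \<open>Mean curvature of graphs and of level sets\<close>

text \<open>Isolates the differentiability of the gradient, which \<open>grad_differentiable\<close>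
  supplies once the graph over \<open>W\<close> has a unit normal.\<close>

locale chart_gradient = chart_function c W u
  for c :: "('m::topological_space, 'a::euclidean_space) rchart" and W u +
  assumes grad_diff: "\<And>p. p \<in> W \<inter> chart_dom c \<Longrightarrow> local_rep c (grad c W u) differentiable (at (coord c p))"
begin

abbreviation "n p \<equiv> grad c W u p"

definition hess :: "'m \<Rightarrow> 'a \<Rightarrow> 'a" where
  "hess p = cov_deriv c W (\<lambda>d. grad d W u) p"

text \<open>The quantity \<open>Q\<close> of the overview; \<open>hess\<close> is the Hessian as an
  endomorphism.\<close>

definition hess_grad :: "'m \<Rightarrow> real" where
  "hess_grad p = rinner c p (hess p (n p)) (n p)"

lemma laplacian_eq: "laplacian c W u p = trace_on UNIV (hess p)"
  by (simp add: laplacian_def hess_def)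

lemma grad_has_derivative:
  assumes p: "p \<in> W \<inter> chart_dom c"
  shows "(local_rep c (grad c W u) has_derivative (\<lambda>v. hess p v - levi_civita c p v (n p))) (at (coord c p))"
proof -
  obtain D where D: "(local_rep c (grad c W u) has_derivative D) (at (coord c p))"
    using grad_diff[OF p] differentiable_def by blast
  have "deriv_along c W (grad c W u) p v = D v" for v
    by (rule deriv_along_eq[OF p open_UNIV _ D]) (auto simp: tangent_space_open[OF open_W p])
  then have "D = (\<lambda>v. hess p v - levi_civita c p v (n p))"
    by (simp add: hess_def cov_deriv_def)
  then show ?thesis using D by simp
qed

lemma hess_linear: "p \<in> W \<inter> chart_dom c \<Longrightarrow> linear (hess p)"
proof -
  assume p: "p \<in> W \<inter> chart_dom c"
  have "linear (\<lambda>v. (hess p v - levi_civita c p v (n p)) + levi_civita c p v (n p))"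
    by (rule linear_compose_add[OF has_derivative_linear[OF grad_has_derivative[OF p]]])
      (use levi_civita_bilinear p in \<open>auto simp: bilinear_def\<close>)
  then show ?thesis by simp
qed

lemma norm_grad_has_derivative:
  assumes p: "p \<in> W \<inter> chart_dom c"
  shows "((\<lambda>x. metric_tensor c x (local_rep c (grad c W u) x) (local_rep c (grad c W u) x))
    has_derivative (\<lambda>v. 2 * rinner c p (hess p v) (n p))) (at (coord c p))"
proof -
  have pc: "p \<in> chart_dom c" using p by blast
  have "rinner c p (n p) (hess p v) = rinner c p (hess p v) (n p)" for v by (rule metric_sym[OF pc])
  then show ?thesis
    by (intro metric_leibniz[OF pc has_derivative_ident refl grad_has_derivative[OF p] grad_has_derivative[OF p],
          THEN has_derivative_eq_rhs] ext)
      (simp add: pc)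
qed

lemma norm_grad_pos: "p \<in> W \<inter> chart_dom c \<Longrightarrow> n p \<noteq> 0 \<Longrightarrow> rinner c p (n p) (n p) > 0"
  using metric_pos by blast

lemma norm_grad_nonneg: "p \<in> W \<inter> chart_dom c \<Longrightarrow> rinner c p (n p) (n p) \<ge> 0"
  using norm_grad_pos[of p] bilinear_lzero[OF metric_bilinear, of p "n p"] by (cases "n p = 0") auto

text \<open>The derivative of \<open>|n|\<close> along \<open>v\<close> is the inner product of
  \<open>hess p v\<close> and \<open>n p\<close> divided by \<open>|n|\<close>, which for
  \<open>v = n p\<close> is \<open>Q / |n|\<close>. The gradient being nonzero makes the square root
  differentiable.\<close>

lemma horizontally_homothetic_at_iff:
  assumes p: "p \<in> W \<inter> chart_dom c" and nz: "n p \<noteq> 0"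
  shows "rinner c p (n p) (grad c W (\<lambda>q. rnorm c q (grad c W u q)) p) = 0 \<longleftrightarrow> hess_grad p = 0"
proof -
  have pc: "p \<in> chart_dom c" using p by blast
  let ?h = "\<lambda>x. metric_tensor c x (local_rep c (grad c W u) x) (local_rep c (grad c W u) x)"
  have h: "?h (coord c q) = rinner c q (n q) (n q)" if "q \<in> chart_dom c" for q
    using that by (simp add: rinner_def)
  have pos: "?h (coord c p) > 0" using h[OF pc] norm_grad_pos[OF p nz] by simp
  have "((\<lambda>x. sqrt (?h x)) has_derivative (\<lambda>v. (2 * rinner c p (hess p v) (n p)) * (inverse (sqrt (?h (coord c p))) / 2))) (at (coord c p))"
    by (rule has_derivative_real_sqrt[OF pos norm_grad_has_derivative[OF p], THEN has_derivative_eq_rhs])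
      (simp add: field_simps)
  then have "(local_rep c (\<lambda>q. rnorm c q (n q)) has_derivative
    (\<lambda>v. (2 * rinner c p (hess p v) (n p)) * (inverse (sqrt (?h (coord c p))) / 2))) (at (coord c p))"
    by (rule has_derivative_transform_within_open[OF _ open_img]) (use pc in \<open>auto simp: rnorm_def h[symmetric]\<close>)
  from rinner_grad_open[OF open_W p this]
  show ?thesis
    using pos by (subst metric_sym[OF pc]) (simp add: hess_grad_def)
qed

text \<open>With the tangent space parametrised by base vectors, differentiating
  \<open>l (- n, 1)\<close> gives \<open>l\<close> times the Hessian plus a rank one term along
  \<open>n\<close>, where \<open>m\<close> is the derivative of \<open>l\<close> along the
  graph.\<close>

lemma graph_shape_operator:
  assumes N: "graph_normal U (N (prod_line_chart c))" and U: "open U" "U \<subseteq> W" and p: "p \<in> U \<inter> chart_dom c"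
  defines "l \<equiv> snd (N (prod_line_chart c) (p, u p))"
  obtains m where "linear m"
    "\<And>v. m v * (1 + rinner c p (n p) (n p)) = - l * rinner c p (hess p v) (n p)"
    "\<And>v. shape_operator (prod_line_chart c) (graph_on U u) N (p, u p) (v, du p v)
      = (l *\<^sub>R hess p v + m v *\<^sub>R n p, du p (l *\<^sub>R hess p v + m v *\<^sub>R n p))"
    "linear (shape_operator (prod_line_chart c) (graph_on U u) N (p, u p))"
proof -
  let ?P = "prod_line_chart c" and ?x = "coord c p"
  let ?N = "N ?P"
  let ?S = "graph_on U u"
  have pW: "p \<in> W \<inter> chart_dom c" and pc: "p \<in> chart_dom c" using U p by auto
  have pS: "(p, u p) \<in> ?S \<inter> chart_dom ?P" using p by (auto simp: graph_on_def)
  note B = metric_bilinear[OF pc]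
  obtain V F F' X where F: "open V" "(coord c p, u p) \<in> V" "(F has_derivative F') (at (coord c p, u p))"
    "\<And>q. q \<in> U \<inter> chart_dom c \<Longrightarrow> (coord c q, u q) \<in> V \<Longrightarrow> F (coord c q, u q) = ?N (q, u q)"
    and X: "((\<lambda>x. F (x, local_rep c u x)) has_derivative (\<lambda>v. F' (v, du p v))) (at (coord c p))"
    "open X" "coord c p \<in> X"
    "\<And>x. x \<in> X \<Longrightarrow> \<exists>q\<in>U \<inter> chart_dom c. x = coord c q \<and> F (x, local_rep c u x) = ?N (q, u q)"
    by (rule graph_normal_extension[OF N U p]) blast
  let ?l = "\<lambda>x. snd (F (x, local_rep c u x))"
  let ?nh = "local_rep c (grad c W u)"
  define m where "m v = snd (F' (v, du p v))" for v
  have lm: "(?l has_derivative m) (at ?x)"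
    unfolding m_def using has_derivative_snd[OF X(1)] .
  have lx: "?l ?x = l"
  proof -
    obtain q where q: "q \<in> U \<inter> chart_dom c" "?x = coord c q" "F (?x, local_rep c u ?x) = ?N (q, u q)"
      using X(4)[OF X(3)] by blast
    have "p = q" using coord_inj[OF pc _ q(2)] q(1) by blast
    then show ?thesis unfolding l_def q(3) by simp
  qed
  have eqX: "(- ?l x *\<^sub>R ?nh x, ?l x) = F (x, local_rep c u x)
      \<and> (?l x)\<^sup>2 * (1 + metric_tensor c x (?nh x) (?nh x)) = 1" if x: "x \<in> X" for x
  proof -
    obtain q where q: "q \<in> U \<inter> chart_dom c" "x = coord c q" "F (x, local_rep c u x) = ?N (q, u q)"
      using X(4)[OF x] by blast
    have qc: "q \<in> chart_dom c" using q by blast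
    have nh: "?nh x = n q" by (simp add: q(2) qc)
    have a: "F (x, local_rep c u x) = (- ?l x *\<^sub>R n q, ?l x)"
      using graph_normal_eq(1)[OF N U(2) q(1)] unfolding q(3) .
    have b: "(?l x)\<^sup>2 * (1 + metric_tensor c x (n q) (n q)) = 1"
      using graph_normal_eq(2)[OF N U(2) q(1)] unfolding q(3) by (simp only: rinner_def q(2))
    show ?thesis unfolding nh by (intro conjI a[symmetric] b)
  qed
  have 1: "((\<lambda>x. (- ?l x *\<^sub>R ?nh x, ?l x)) has_derivative
      (\<lambda>v. (- l *\<^sub>R (hess p v - levi_civita c p v (n p)) + (- m v) *\<^sub>R n p, m v))) (at ?x)"
    using has_derivative_Pair[OF has_derivative_scaleR[OF has_derivative_minus[OF lm] grad_has_derivative[OF pW]] lm]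
    by (simp only: lx[unfolded local_rep_coord[OF pc]] local_rep_coord[OF pc])
  have "((\<lambda>x. F (x, local_rep c u x)) has_derivative
      (\<lambda>v. (- l *\<^sub>R (hess p v - levi_civita c p v (n p)) + (- m v) *\<^sub>R n p, m v))) (at ?x)"
    by (rule has_derivative_transform_within_open[OF 1 X(2,3)]) (use eqX in blast)
  from has_derivative_unique[OF X(1) this]
  have F': "F' (v, du p v) = (- l *\<^sub>R (hess p v - levi_civita c p v (n p)) + (- m v) *\<^sub>R n p, m v)" for v
    by (rule fun_cong)
  \<comment> \<open>The differentiated function is constantly 1 on \<open>X\<close>; after
    cancelling \<open>2 l\<close> this expresses \<open>m\<close> through the Hessian.\<close>
  have "((\<lambda>x. (?l x)\<^sup>2 * (1 + metric_tensor c x (?nh x) (?nh x))) has_derivative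
    (\<lambda>v. (?l ?x)\<^sup>2 * (0 + 2 * rinner c p (hess p v) (n p)) +
        (of_nat 2 * m v * (?l ?x) ^ (2 - 1)) * (1 + metric_tensor c ?x (?nh ?x) (?nh ?x)))) (at ?x)"
    by (intro has_derivative_mult has_derivative_add has_derivative_const has_derivative_power lm
        norm_grad_has_derivative pW)
  then have "((\<lambda>x. 1) has_derivative
    (\<lambda>v. (?l ?x)\<^sup>2 * (0 + 2 * rinner c p (hess p v) (n p)) +
        (of_nat 2 * m v * (?l ?x) ^ (2 - 1)) * (1 + metric_tensor c ?x (?nh ?x) (?nh ?x)))) (at ?x)"
    by (rule has_derivative_transform_within_open[OF _ X(2,3)]) (use eqX in blast)
  from fun_cong[OF has_derivative_unique[OF has_derivative_const this]]
  have "2 * l * (l * rinner c p (hess p v) (n p) + m v * (1 + rinner c p (n p) (n p))) = 0" for v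
    by (simp add: lx[unfolded local_rep_coord[OF pc]] pc rinner_def power2_eq_square algebra_simps)
  moreover have l0: "l \<noteq> 0" using graph_normal_eq(2)[OF N U(2) p] unfolding l_def by auto
  ultimately have m1: "m v * (1 + rinner c p (n p) (n p)) = - l * rinner c p (hess p v) (n p)" for v
    by (simp add: eq_neg_iff_add_eq_0 add.commute)
  have ext_eq: "F (coord ?P z) = ?N z" if "z \<in> ?S \<inter> chart_dom ?P" "coord ?P z \<in> V" for z
    using that F(4) by (auto simp: graph_on_def)
  have T: "(v, du p v) \<in> tangent_space ?P ?S (p, u p)" for v
    using tangent_space_graph[OF U p] by blast
  have FP: "coord ?P (p, u p) \<in> V" "(F has_derivative F') (at (coord ?P (p, u p)))"
    using F(2,3) by simp_all
  have D: "deriv_along ?P ?S ?N (p, u p) (v, du p v) = F' (v, du p v)" for v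
    by (rule prod.deriv_along_eq[OF pS F(1) FP ext_eq T])
  have lD: "linear (deriv_along ?P ?S ?N (p, u p))"
    by (rule prod.deriv_along_linear[OF pS F(1) FP ext_eq])
  have Np: "?N (p, u p) = (- l *\<^sub>R n p, l)"
    unfolding l_def by (rule graph_normal_eq(1)[OF N U(2) p])
  note BL = levi_civita_bilinear[OF pc]
  have "shape_operator ?P ?S N (p, u p) (v, du p v) = (l *\<^sub>R hess p v + m v *\<^sub>R n p, - m v)" for v
    by (simp add: shape_operator_def cov_deriv_def D F' levi_civita_prod[OF pc] Np
        bilinear_rneg[OF BL] bilinear_rmul[OF BL] algebra_simps)
  \<comment> \<open>By the formula for \<open>m\<close>, the vertical component \<open>- m v\<close>
    is the differential of \<open>u\<close> on the horizontal one: the image is tangent to the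
    graph.\<close>
  moreover have "du p (l *\<^sub>R hess p v + m v *\<^sub>R n p) = - m v" for v
    using m1[of v] rinner_grad'[OF pW, of "l *\<^sub>R hess p v + m v *\<^sub>R n p", symmetric]
    by (simp add: bilinear_ladd[OF B] bilinear_lmul[OF B] algebra_simps)
  moreover have "linear (shape_operator ?P ?S N (p, u p))"
  proof -
    have "linear (\<lambda>v. - (deriv_along ?P ?S ?N (p, u p) v + levi_civita ?P (p, u p) v (?N (p, u p))))"
      using prod.levi_civita_bilinear[of "(p, u p)", unfolded bilinear_def] pc
      by (intro linear_compose_neg linear_compose_add lD) (simp del: split_paired_All)
    moreover have "shape_operator ?P ?S N (p, u p)
        = (\<lambda>v. - (deriv_along ?P ?S ?N (p, u p) v + levi_civita ?P (p, u p) v (?N (p, u p))))"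
      by (rule ext) (simp add: shape_operator_def cov_deriv_def)
    ultimately show ?thesis by (simp only:)
  qed
  moreover have "linear m" using has_derivative_linear[OF lm] .
  ultimately show ?thesis using that m1 by presburger
qed

text \<open>The trace is \<open>l L + m (n p)\<close>. Multiplication by the positive number
  \<open>1 + |n|^2\<close> clears the denominator hidden in \<open>m\<close> and leaves
  \<open>l ((1 + |n|^2) L - Q)\<close>.\<close>

lemma graph_mean_curvature_zero_iff:
  assumes N: "graph_normal U (N (prod_line_chart c))" and U: "open U" "U \<subseteq> W" and p: "p \<in> U \<inter> chart_dom c"
  shows "mean_curvature (prod_line_chart c) (graph_on U u) N (p, u p) = 0 \<longleftrightarrow>
    (1 + rinner c p (n p) (n p)) * laplacian c W u p = hess_grad p"
proof -
  let ?P = "prod_line_chart c" and ?l = "snd (N (prod_line_chart c) (p, u p))"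
  have pW: "p \<in> W \<inter> chart_dom c" using U p by auto
  obtain m where m: "linear m"
    "\<And>v. m v * (1 + rinner c p (n p) (n p)) = - ?l * rinner c p (hess p v) (n p)"
    "\<And>v. shape_operator ?P (graph_on U u) N (p, u p) (v, du p v)
      = (?l *\<^sub>R hess p v + m v *\<^sub>R n p, du p (?l *\<^sub>R hess p v + m v *\<^sub>R n p))"
    "linear (shape_operator ?P (graph_on U u) N (p, u p))"
    by (rule graph_shape_operator[where N = N, OF N U p]) blast
  have l0: "?l \<noteq> 0" using graph_normal_eq(2)[OF N U(2) p] by auto
  have "mean_curvature ?P (graph_on U u) N (p, u p)
      = trace_on UNIV (\<lambda>v. ?l *\<^sub>R hess p v + m v *\<^sub>R n p)"
    unfolding mean_curvature_def tangent_space_graph[OF U p]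
  proof (rule trace_on_range)
    show "linear (\<lambda>v. (v, du p v))" using du_linear[OF pW] by (auto simp: linear_iff)
    show "linear (\<lambda>v. ?l *\<^sub>R hess p v + m v *\<^sub>R n p)"
      using hess_linear[OF pW] m(1) by (auto simp: linear_iff algebra_simps)
  qed (use m in \<open>auto simp: inj_def\<close>)
  also have "\<dots> = ?l * laplacian c W u p + m (n p)"
    using trace_on_UNIV_scale_rank_one[OF hess_linear[OF pW] m(1)] by (simp add: laplacian_eq)
  finally have H: "mean_curvature ?P (graph_on U u) N (p, u p) * (1 + rinner c p (n p) (n p))
      = ?l * ((1 + rinner c p (n p) (n p)) * laplacian c W u p - hess_grad p)"
    using m(2)[of "n p"] by (simp add: hess_grad_def algebra_simps)
  have "mean_curvature ?P (graph_on U u) N (p, u p) = 0 \<longleftrightarrow>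
      mean_curvature ?P (graph_on U u) N (p, u p) * (1 + rinner c p (n p) (n p)) = 0"
    using norm_grad_nonneg[OF pW] by simp
  then show ?thesis unfolding H using l0 by simp
qed

text \<open>The graph carries the metric of the base plus the square of \<open>du p\<close>. Hence
  \<open>a n\<close> pairs with the lift of \<open>w\<close> to \<open>a (1 + |n|^2)\<close> times
  \<open>du p w\<close>, which fixes the factor.\<close>

lemma height_grad_graph:
  assumes U: "open U" "U \<subseteq> W" and p: "p \<in> U \<inter> chart_dom c"
  defines "v \<equiv> inverse (1 + rinner c p (n p) (n p)) *\<^sub>R n p"
  shows "height_grad (prod_line_chart c) (graph_on U u) (p, u p) = (v, du p v)"
proof -
  let ?P = "prod_line_chart c"
  have pW: "p \<in> W \<inter> chart_dom c" and pc: "p \<in> chart_dom c" using U p by auto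
  note B = metric_bilinear[OF pc]
  have pS: "(p, u p) \<in> graph_on U u \<inter> chart_dom ?P" using p by (auto simp: graph_on_def)
  have W0: "1 + rinner c p (n p) (n p) \<noteq> 0" using norm_grad_nonneg[OF pW] by linarith
  show ?thesis
    unfolding height_grad_def
  proof (rule prod.grad_eqI)
    show "subspace (tangent_space ?P (graph_on U u) (p, u p))"
      unfolding tangent_space_graph[OF U p] by (rule subspace_graph[OF pW])
    show "(v, du p v) \<in> tangent_space ?P (graph_on U u) (p, u p)"
      unfolding tangent_space_graph[OF U p] by blast
    fix w assume w: "w \<in> tangent_space ?P (graph_on U u) (p, u p)"
    then obtain w1 where w1: "w = (w1, du p w1)" unfolding tangent_space_graph[OF U p] by blast
    have "deriv_along ?P (graph_on U u) snd (p, u p) w = snd w"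
      by (rule prod.deriv_along_eq[OF pS open_UNIV UNIV_I has_derivative_snd[OF has_derivative_ident] _ w])
        (auto simp: graph_on_def)
    moreover have "du p v = inverse (1 + rinner c p (n p) (n p)) * rinner c p (n p) (n p)"
      unfolding v_def by (simp add: linear_cmul[OF du_linear[OF pW]] rinner_grad[OF pW, symmetric] bilinear_rmul[OF B])
    then have "rinner ?P (p, u p) (v, du p v) w = snd w"
      using W0 by (simp add: w1 v_def bilinear_lmul[OF B] rinner_grad[OF pW] field_simps)
    ultimately show "rinner ?P (p, u p) (v, du p v) w = deriv_along ?P (graph_on U u) snd (p, u p) w" by simp
  qed (simp add: pc)
qed

text \<open>Pairing a tangent vector with the height gradient returns its vertical component, here
  \<open>- m v\<close>. As \<open>v = a n\<close> with \<open>a = 1 / (1 + |n|^2)\<close>, the value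
  is \<open>l a^2 Q\<close>.\<close>

lemma graph_asymptotic_iff:
  assumes N: "graph_normal U (N (prod_line_chart c))" and U: "open U" "U \<subseteq> W" and p: "p \<in> U \<inter> chart_dom c"
  shows "rinner (prod_line_chart c) (p, u p)
      (shape_operator (prod_line_chart c) (graph_on U u) N (p, u p) (height_grad (prod_line_chart c) (graph_on U u) (p, u p)))
      (height_grad (prod_line_chart c) (graph_on U u) (p, u p)) = 0 \<longleftrightarrow> hess_grad p = 0"
proof -
  let ?P = "prod_line_chart c" and ?l = "snd (N (prod_line_chart c) (p, u p))"
  have pW: "p \<in> W \<inter> chart_dom c" and pc: "p \<in> chart_dom c" using U p by auto
  note B = metric_bilinear[OF pc]
  obtain m where m: "linear m"
    "\<And>v. m v * (1 + rinner c p (n p) (n p)) = - ?l * rinner c p (hess p v) (n p)"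
    "\<And>v. shape_operator ?P (graph_on U u) N (p, u p) (v, du p v)
      = (?l *\<^sub>R hess p v + m v *\<^sub>R n p, du p (?l *\<^sub>R hess p v + m v *\<^sub>R n p))"
    by (rule graph_shape_operator[where N = N, OF N U p]) blast
  define a where "a = inverse (1 + rinner c p (n p) (n p))"
  define v where "v = a *\<^sub>R n p"
  have a: "a > 0" unfolding a_def using norm_grad_nonneg[OF pW] by simp
  have l0: "?l \<noteq> 0" using graph_normal_eq(2)[OF N U(2) p] by auto
  have hg: "height_grad ?P (graph_on U u) (p, u p) = (v, du p v)"
    unfolding v_def a_def by (rule height_grad_graph[OF U p])
  define r where "r = ?l *\<^sub>R hess p v + m v *\<^sub>R n p"
  have r: "rinner ?P (p, u p) (r, du p r) (v, du p v) = rinner c p r v + du p r * du p v"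
    by simp
  have dv: "du p v = a * rinner c p (n p) (n p)"
    unfolding v_def by (simp add: linear_cmul[OF du_linear[OF pW]] rinner_grad[OF pW, symmetric] bilinear_rmul[OF B])
  have rv: "rinner c p r v = a * du p r"
    unfolding v_def by (simp add: bilinear_rmul[OF B] rinner_grad'[OF pW])
  have dr: "du p r = ?l * rinner c p (hess p v) (n p) + m v * rinner c p (n p) (n p)"
    unfolding rinner_grad'[OF pW, symmetric] r_def by (simp add: bilinear_ladd[OF B] bilinear_lmul[OF B])
  have hv: "rinner c p (hess p v) (n p) = a * hess_grad p"
    unfolding v_def hess_grad_def by (simp add: linear_cmul[OF hess_linear[OF pW]] bilinear_lmul[OF B])
  have "rinner ?P (p, u p) (r, du p r) (v, du p v) = a * du p r * (1 + rinner c p (n p) (n p))"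
    using r rv dv by (simp add: algebra_simps)
  also have "\<dots> = du p r" using norm_grad_nonneg[OF pW] by (simp add: a_def)
  also have "du p r = - m v" using dr m(2)[of v] by (simp add: algebra_simps)
  also have "m v = (m v * (1 + rinner c p (n p) (n p))) * a"
    using norm_grad_nonneg[OF pW] by (simp add: a_def)
  also have "\<dots> = - ?l * (a * hess_grad p) * a" by (simp only: m(2) hv)
  finally show ?thesis using a l0 by (simp add: hg m(3) r_def[symmetric])
qed

section \<open>Level sets of the function\<close>

text \<open>One inclusion differentiates the constancy of \<open>u\<close> along a curve. The other
  needs an actual curve, from \<open>smooth_curve_in_level_set\<close>, whose nondegeneracy
  condition is the nonvanishing of the gradient.\<close>

lemma tangent_space_level:
  assumes U: "open U" "U \<subseteq> W" and p: "p \<in> U \<inter> chart_dom c" "u p = t" and nz: "n p \<noteq> 0"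
  shows "tangent_space c {q \<in> U. u q = t} p = {v. du p v = 0}"
proof (intro equalityI subsetI)
  let ?S = "{q \<in> U. u q = t}"
  have pW: "p \<in> W \<inter> chart_dom c" using U p by auto
  fix v assume "v \<in> tangent_space c ?S p"
  then obtain \<gamma> e where \<gamma>: "e > 0" "\<gamma> ` {-e<..<e} \<subseteq> coord c ` (?S \<inter> chart_dom c)"
    "\<gamma> 0 = coord c p" "(\<gamma> has_derivative (\<lambda>h. h *\<^sub>R v)) (at (0::real))"
    unfolding tangent_space_def has_vector_derivative_def by blast
  have d: "((\<lambda>s. local_rep c u (\<gamma> s)) has_derivative (\<lambda>h. du p (h *\<^sub>R v))) (at 0)"
    by (rule has_derivative_compose[OF \<gamma>(4)]) (simp add: \<gamma>(3) du_has_derivative[OF pW])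
  have "((\<lambda>s. t) has_derivative (\<lambda>h. du p (h *\<^sub>R v))) (at 0)"
  proof (rule has_derivative_transform_within_open[OF d])
    show "local_rep c u (\<gamma> s) = t" if "s \<in> {-e<..<e}" for s
    proof -
      have "\<gamma> s \<in> coord c ` (?S \<inter> chart_dom c)" using \<gamma>(2) that by blast
      then show ?thesis by auto
    qed
  qed (use \<gamma>(1) in auto)
  from fun_cong[OF has_derivative_unique[OF this has_derivative_const], of 1]
  show "v \<in> {v. du p v = 0}" by simp
next
  let ?S = "{q \<in> U. u q = t}" and ?U = "coord c ` (U \<inter> chart_dom c)"
  have pW: "p \<in> W \<inter> chart_dom c" and pc: "p \<in> chart_dom c" using U p by auto
  fix v assume v: "v \<in> {v. du p v = 0}"
  have "?U \<subseteq> coord c ` (W \<inter> chart_dom c)" using U(2) by blast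
  then have sm: "smooth_on ?U (local_rep c u)" using smooth_on_subset[OF smooth_u] by blast
  have "du p (n p) \<noteq> 0" using norm_grad_pos[OF pW nz] rinner_grad[OF pW, of "n p"] by simp
  then have 0: "du p \<noteq> (\<lambda>v. 0)" by auto
  obtain \<gamma> e where \<gamma>: "e > 0" "smooth_on {-e<..<e} \<gamma>"
    "\<And>s. s \<in> {-e<..<e} \<Longrightarrow> \<gamma> s \<in> ?U \<and> local_rep c u (\<gamma> s) = local_rep c u (coord c p)"
    "\<gamma> 0 = coord c p" "(\<gamma> has_vector_derivative v) (at (0::real))"
    by (rule smooth_curve_in_level_set[OF open_coord_image[OF U(1)] imageI[OF p(1)] sm, of v])
      (use v 0 in \<open>auto simp: du_def\<close>)
  show "v \<in> tangent_space c ?S p"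
  proof (rule tangent_spaceI[OF \<gamma>(1,2) _ \<gamma>(4,5)])
    show "\<gamma> s \<in> coord c ` (?S \<inter> chart_dom c)" if "s \<in> {-e<..<e}" for s
      using \<gamma>(3)[OF that] p(2) pc by auto
  qed
qed

text \<open>On the kernel of \<open>du p\<close> the shape operator is \<open>- \<mu>\<close> times
  the Hessian up to a multiple of \<open>n\<close>. By \<open>trace_on_hyperplane\<close> its trace
  is \<open>- \<mu>\<close> times the full Laplacian less the normal contribution
  \<open>Q / |n|^2\<close>.\<close>

lemma level_mean_curvature_zero_iff:
  assumes U: "open U" "U \<subseteq> W" and p: "p \<in> U \<inter> chart_dom c" "u p = t"
    and nz: "\<And>q. q \<in> U \<inter> chart_dom c \<Longrightarrow> n q \<noteq> 0"
    and unit: "\<And>q. q \<in> U \<inter> chart_dom c \<Longrightarrow> u q = t \<Longrightarrow> rinner c q (N c q) (N c q) = 1"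
    and normal: "\<And>q v. q \<in> U \<inter> chart_dom c \<Longrightarrow> u q = t \<Longrightarrow> du q v = 0 \<Longrightarrow> rinner c q (N c q) v = 0"
    and V: "open V" "coord c p \<in> V" "smooth_on V F"
    and F: "\<And>q. q \<in> U \<inter> chart_dom c \<Longrightarrow> u q = t \<Longrightarrow> coord c q \<in> V \<Longrightarrow> F (coord c q) = N c q"
  shows "mean_curvature c {q \<in> U. u q = t} N p = 0 \<longleftrightarrow>
    rinner c p (n p) (n p) * laplacian c W u p = hess_grad p"
proof -
  let ?S = "{q \<in> U. u q = t}" and ?x = "coord c p"
  let ?nh = "local_rep c (grad c W u)"
  let ?nn = "\<lambda>x. metric_tensor c x (?nh x) (?nh x)"
  have pW: "p \<in> W \<inter> chart_dom c" and pc: "p \<in> chart_dom c" using U p by auto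
  have pS: "p \<in> ?S \<inter> chart_dom c" using p by auto
  note B = metric_bilinear[OF pc]
  have npos: "rinner c p (n p) (n p) > 0" using norm_grad_pos[OF pW nz[OF p(1)]] .
  obtain F' where F': "(F has_derivative F') (at ?x)"
    using smooth_on_has_derivative[OF V(3,1,2)] by blast
  \<comment> \<open>Along the level set \<open>N = \<mu> n\<close>, so \<open>\<mu> n\<close> may replace the given extension \<open>F\<close>.\<close>
  define \<mu> where "\<mu> x = metric_tensor c x (F x) (?nh x) / ?nn x" for x
  have "(\<lambda>x. metric_tensor c x (F x) (?nh x)) differentiable (at ?x)"
    using metric_leibniz[OF pc has_derivative_ident refl F' grad_has_derivative[OF pW]] differentiable_def by blast
  moreover have "?nn differentiable (at ?x)"
    using norm_grad_has_derivative[OF pW] differentiable_def by blast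
  moreover have "?nn ?x \<noteq> 0" using npos pc by (simp add: rinner_def)
  ultimately have "\<mu> differentiable (at ?x)" unfolding \<mu>_def by (intro differentiable_divide) auto
  then obtain m where m: "(\<mu> has_derivative m) (at ?x)" unfolding differentiable_def by blast
  have F\<mu>: "\<mu> (coord c q) *\<^sub>R n q = N c q \<and> (\<mu> (coord c q))\<^sup>2 * rinner c q (n q) (n q) = 1"
    if q: "q \<in> ?S \<inter> chart_dom c" "coord c q \<in> V" for q
  proof -
    have qU: "q \<in> U \<inter> chart_dom c" and qW: "q \<in> W \<inter> chart_dom c" and qc: "q \<in> chart_dom c" and qt: "u q = t"
      using q U by auto
    note Bq = metric_bilinear[OF qc]
    have np: "rinner c q (n q) (n q) > 0" using norm_grad_pos[OF qW nz[OF qU]] .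
    let ?m = "\<mu> (coord c q)"
    have m': "?m * rinner c q (n q) (n q) = rinner c q (N c q) (n q)"
      using F[OF qU qt q(2)] np qc by (simp add: \<mu>_def rinner_def)
    \<comment> \<open>By the choice of \<open>\<mu>\<close> this vector is orthogonal to
      \<open>n q\<close>, hence tangent to the level set, hence orthogonal to \<open>N c q\<close>
      too. So it is orthogonal to itself.\<close>
    let ?v = "N c q - ?m *\<^sub>R n q"
    have "du q ?v = 0"
      unfolding rinner_grad'[OF qW, symmetric] using m'
      by (simp add: bilinear_lsub[OF Bq] bilinear_lmul[OF Bq])
    then have "rinner c q (n q) ?v = 0" "rinner c q (N c q) ?v = 0"
      using rinner_grad[OF qW, of ?v] normal[OF qU qt] by auto
    then have "rinner c q ?v ?v = 0" by (simp only: bilinear_lsub[OF Bq] bilinear_lmul[OF Bq]) simp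
    then have N: "N c q = ?m *\<^sub>R n q" using metric_pos[OF qc, of ?v] by fastforce
    moreover have "?m\<^sup>2 * rinner c q (n q) (n q) = 1"
      using unit[OF qU qt] unfolding N by (simp add: bilinear_lmul[OF Bq] bilinear_rmul[OF Bq] power2_eq_square mult.assoc)
    ultimately show ?thesis by metis
  qed
  have \<mu>0: "\<mu> ?x \<noteq> 0" using F\<mu>[OF pS V(2)] by auto
  have T: "tangent_space c ?S p = {v. du p v = 0}" by (rule tangent_space_level[OF U p nz[OF p(1)]])
  have dF: "((\<lambda>x. \<mu> x *\<^sub>R ?nh x) has_derivative
      (\<lambda>v. \<mu> ?x *\<^sub>R (hess p v - levi_civita c p v (n p)) + m v *\<^sub>R n p)) (at ?x)"
    using has_derivative_scaleR[OF m grad_has_derivative[OF pW]] by (simp only: local_rep_coord[OF pc])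
  have ext_eq: "\<mu> (coord c q) *\<^sub>R ?nh (coord c q) = N c q" if "q \<in> ?S \<inter> chart_dom c" "coord c q \<in> V" for q
    using F\<mu>[OF that] that(1) by simp
  have D: "deriv_along c ?S (N c) p v = \<mu> ?x *\<^sub>R (hess p v - levi_civita c p v (n p)) + m v *\<^sub>R n p"
    if "du p v = 0" for v
    by (rule deriv_along_eq[OF pS V(1,2) dF ext_eq]) (use that T in auto)
  have lD: "linear (deriv_along c ?S (N c) p)"
    by (rule deriv_along_linear[OF pS V(1,2) dF ext_eq])
  have d1: "((\<lambda>x. (\<mu> x)\<^sup>2 * ?nn x) has_derivative
      (\<lambda>v. (\<mu> ?x)\<^sup>2 * (2 * rinner c p (hess p v) (n p)) + (of_nat 2 * m v * \<mu> ?x ^ (2 - 1)) * ?nn ?x)) (at ?x)"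
    by (intro has_derivative_mult has_derivative_power m norm_grad_has_derivative[OF pW])
  \<comment> \<open>The normalisation of \<open>\<mu>\<close> holds on the level set only, so it is
    differentiated in tangential directions only: there the two extensions of the function 1, the
    normalisation and the constant, have the same derivative.\<close>
  have tang: "\<mu> ?x * rinner c p (hess p v) (n p) + m v * rinner c p (n p) (n p) = 0" if v: "du p v = 0" for v
  proof -
    have vT: "v \<in> tangent_space c ?S p" using v T by simp
    have "deriv_along c ?S (\<lambda>_. 1 :: real) p v =
      (\<mu> ?x)\<^sup>2 * (2 * rinner c p (hess p v) (n p)) + (of_nat 2 * m v * \<mu> ?x ^ (2 - 1)) * ?nn ?x"
      by (rule deriv_along_eq[OF pS V(1,2) d1 _ vT]) (use F\<mu> in \<open>auto simp: rinner_def\<close>)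
    moreover have "deriv_along c ?S (\<lambda>_. 1 :: real) p v = 0"
      by (rule deriv_along_eq[OF pS V(1,2) has_derivative_const _ vT]) simp
    ultimately have "2 * \<mu> ?x * (\<mu> ?x * rinner c p (hess p v) (n p) + m v * rinner c p (n p) (n p)) = 0"
      using pc by (simp add: rinner_def power2_eq_square algebra_simps)
    then show ?thesis using \<mu>0 by simp
  qed
  note BL = levi_civita_bilinear[OF pc]
  let ?K = "\<lambda>v. (- \<mu> ?x) *\<^sub>R hess p v"
  have Np: "N c p = \<mu> ?x *\<^sub>R n p" using F\<mu>[OF pS V(2)] by simp
  have LK: "shape_operator c ?S N p v = ?K v + (- m v) *\<^sub>R n p" if "du p v = 0" for v
    by (simp add: shape_operator_def cov_deriv_def D[OF that] Np bilinear_rmul[OF BL] algebra_simps)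
  have LT: "du p (shape_operator c ?S N p v) = 0" if v: "du p v = 0" for v
    unfolding LK[OF v] rinner_grad'[OF pW, symmetric] using tang[OF v]
    by (simp add: bilinear_lsub[OF B] bilinear_lneg[OF B] bilinear_lmul[OF B])
  have lL: "linear (shape_operator c ?S N p)"
  proof -
    have "linear (\<lambda>v. - (deriv_along c ?S (N c) p v + levi_civita c p v (N c p)))"
      using BL by (intro linear_compose_neg linear_compose_add lD) (auto simp: bilinear_def)
    moreover have "shape_operator c ?S N p = (\<lambda>v. - (deriv_along c ?S (N c) p v + levi_civita c p v (N c p)))"
      by (rule ext) (simp add: shape_operator_def cov_deriv_def)
    ultimately show ?thesis by (simp only:)
  qed
  have lK: "linear ?K" using hess_linear[OF pW] by (auto simp: linear_iff algebra_simps)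
  have dn: "du p (n p) = rinner c p (n p) (n p)" using rinner_grad[OF pW] by simp
  have "trace_on UNIV ?K = mean_curvature c ?S N p + du p (?K (n p)) / du p (n p)"
    unfolding mean_curvature_def T
    by (rule trace_on_hyperplane[OF du_linear[OF pW] _ lK lL LK LT]) (use dn npos in auto)
  moreover have "du p (?K (n p)) = - \<mu> ?x * hess_grad p"
    unfolding rinner_grad'[OF pW, symmetric] hess_grad_def
    by (simp add: bilinear_lneg[OF B] bilinear_lmul[OF B])
  moreover have "trace_on UNIV ?K = - \<mu> ?x * laplacian c W u p"
    using trace_on_UNIV_scale_rank_one[OF hess_linear[OF pW] linear_zero, of "- \<mu> ?x"] by (simp add: laplacian_eq)
  ultimately have H: "mean_curvature c ?S N p * rinner c p (n p) (n p)
      = - \<mu> ?x * (rinner c p (n p) (n p) * laplacian c W u p - hess_grad p)"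
    using npos dn by (simp add: field_simps)
  have "mean_curvature c ?S N p = 0 \<longleftrightarrow> mean_curvature c ?S N p * rinner c p (n p) (n p) = 0"
    using npos by simp
  then show ?thesis unfolding H using \<mu>0 by simp
qed

end

section \<open>Graphs over domains of a manifold\<close>

text \<open>The Jacobian between product charts is block diagonal, so the horizontal part of a field
  on the product transforms like a vector of the base.\<close>

lemma transition_deriv_prod:
  fixes M :: "('m::{t2_space,second_countable_topology}, 'a::euclidean_space) rchart set"
  assumes M: "riemannian_manifold M" and cd: "c \<in> M" "d \<in> M" and p: "p \<in> chart_dom c \<inter> chart_dom d"
    and c: "riemannian_chart c"
  shows "linear (transition_deriv c d p)"
    and "transition_deriv (prod_line_chart c) (prod_line_chart d) (p, t) v = (transition_deriv c d p (fst v), snd v)"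
proof -
  interpret riemannian_chart c by (rule c)
  interpret prod: riemannian_chart "prod_line_chart c" by (rule riemannian_chart_prod)
  have op: "open (coord c ` (chart_dom c \<inter> chart_dom d))"
    using M cd(2) open_coord_image[of "chart_dom d"]
    unfolding riemannian_manifold_def smooth_atlas_def by (simp add: Int_commute)
  have "smooth_on (coord c ` (chart_dom c \<inter> chart_dom d)) (local_rep c (coord d))"
    using M cd unfolding riemannian_manifold_def smooth_atlas_def by blast
  from smooth_on_has_derivative[OF this op imageI[OF p]]
  have D: "(local_rep c (coord d) has_derivative transition_deriv c d p) (at (coord c p))"
    unfolding transition_deriv_def .
  then show "linear (transition_deriv c d p)" by (rule has_derivative_linear)
  let ?O = "coord c ` (chart_dom c \<inter> chart_dom d) \<times> (UNIV :: real set)"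
  have "((\<lambda>z. (local_rep c (coord d) (fst z), snd z)) has_derivative
      (\<lambda>z. (transition_deriv c d p (fst z), snd z))) (at (coord c p, t))"
    by (intro has_derivative_Pair has_derivative_snd has_derivative_ident
        has_derivative_compose[OF has_derivative_fst[OF has_derivative_ident]]) (simp add: D)
  then have "(local_rep (prod_line_chart c) (coord (prod_line_chart d)) has_derivative
      (\<lambda>z. (transition_deriv c d p (fst z), snd z))) (at (coord c p, t))"
  proof (rule has_derivative_transform_within_open)
    show "open ?O" using op by (intro open_Times) auto
    show "(coord c p, t) \<in> ?O" using p by auto
    fix z assume "z \<in> ?O"
    then obtain q where q: "q \<in> chart_dom c" "q \<in> chart_dom d" "fst z = coord c q" by auto
    have z: "z = coord (prod_line_chart c) (q, snd z)" using q(3) by (cases z) simp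
    show "(local_rep c (coord d) (fst z), snd z) = local_rep (prod_line_chart c) (coord (prod_line_chart d)) z"
      by (subst (3) z, subst prod.local_rep_coord) (use q in simp_all)
  qed
  from fun_cong[OF frechet_derivative_at[OF this], of v, symmetric]
  show "transition_deriv (prod_line_chart c) (prod_line_chart d) (p, t) v = (transition_deriv c d p (fst v), snd v)"
    unfolding transition_deriv_def[of "prod_line_chart c"] prod_line_chart_sel(2) .
qed

locale manifold_graph =
  fixes M :: "('m::{t2_space,second_countable_topology}, 'a::euclidean_space) rchart set"
    and \<Omega> :: "'m set" and u :: "'m \<Rightarrow> real"
    and N :: "('m \<times> real, 'a \<times> real) rchart \<Rightarrow> 'm \<times> real \<Rightarrow> 'a \<times> real"
  assumes riem: "riemannian_manifold M"
    and open_\<Omega>: "open \<Omega>" and \<Omega>_carrier: "\<Omega> \<subseteq> carrier_of M"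
    and smooth: "smooth_fun_on M \<Omega> u"
    and grad_nz: "\<And>c p. c \<in> M \<Longrightarrow> p \<in> \<Omega> \<inter> chart_dom c \<Longrightarrow> grad c \<Omega> u p \<noteq> 0"
    and normal: "unit_normal_field (prod_line M) (graph_on \<Omega> u) N"
begin

lemma chart: "c \<in> M \<Longrightarrow> riemannian_chart c"
  using riem unfolding riemannian_manifold_def smooth_atlas_def riemannian_chart_def by blast

lemma chart_function: "c \<in> M \<Longrightarrow> chart_function c \<Omega> u"
  using chart open_\<Omega> smooth
  unfolding chart_function_def chart_function_axioms_def smooth_fun_on_def by blast

text \<open>Applied both to the given normal with \<open>U = \<Omega>\<close> and, over a smaller
  \<open>U\<close>, to the local normals that minimality supplies.\<close>

lemma graph_normal:
  assumes c: "c \<in> M" and U: "open U" "U \<subseteq> \<Omega>"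
    and N: "unit_normal_field (prod_line M) (graph_on U u) N'"
  shows "chart_function.graph_normal c u U (N' (prod_line_chart c))"
proof -
  interpret chart_function c \<Omega> u by (rule chart_function[OF c])
  let ?P = "prod_line_chart c"
  have P: "?P \<in> prod_line M" using c by (simp add: prod_line_def)
  show ?thesis
    unfolding graph_normal_def
  proof (intro ballI conjI)
    fix p assume p: "p \<in> U \<inter> chart_dom c"
    have pS: "(p, u p) \<in> graph_on U u \<inter> chart_dom ?P" using p by (auto simp: graph_on_def)
    have 1: "rnorm ?P (p, u p) (N' ?P (p, u p)) = 1"
      and 2: "\<forall>v\<in>tangent_space ?P (graph_on U u) (p, u p). rinner ?P (p, u p) (N' ?P (p, u p)) v = 0"
      using N P pS unfolding unit_normal_field_def by blast+
    show "rinner ?P (p, u p) (N' ?P (p, u p)) (N' ?P (p, u p)) = 1"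
      using 1 unfolding rnorm_def by simp
    show "\<forall>v. rinner ?P (p, u p) (N' ?P (p, u p)) (v, du p v) = 0"
      using 2 unfolding tangent_space_graph[OF U p] by blast
    have "\<exists>V F. open V \<and> coord ?P (p, u p) \<in> V \<and> smooth_on V F \<and>
        (\<forall>z\<in>graph_on U u \<inter> chart_dom ?P. coord ?P z \<in> V \<longrightarrow> F (coord ?P z) = N' ?P z)"
      using N P pS unfolding unit_normal_field_def smooth_field_along_def by blast
    then obtain V F where "open V" "coord ?P (p, u p) \<in> V" "smooth_on V F"
      and F: "\<And>z. z \<in> graph_on U u \<inter> chart_dom ?P \<Longrightarrow> coord ?P z \<in> V \<Longrightarrow> F (coord ?P z) = N' ?P z" by blast
    moreover have "F (coord c q, u q) = N' ?P (q, u q)" if "q \<in> U \<inter> chart_dom c" "(coord c q, u q) \<in> V" for q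
      using F[of "(q, u q)"] that by (auto simp: graph_on_def)
    ultimately show "\<exists>V F. open V \<and> (coord c p, u p) \<in> V \<and> smooth_on V F \<and>
        (\<forall>q\<in>U \<inter> chart_dom c. (coord c q, u q) \<in> V \<longrightarrow> F (coord c q, u q) = N' ?P (q, u q))"
      by (intro exI[of _ V] exI[of _ F]) simp
  qed
qed

text \<open>The unit normal \<open>N\<close> of the whole graph is what makes the gradient
  differentiable in each chart.\<close>

lemma chart_gradient: "c \<in> M \<Longrightarrow> chart_gradient c \<Omega> u"
proof -
  assume c: "c \<in> M"
  interpret chart_function c \<Omega> u by (rule chart_function[OF c])
  show ?thesis
    by unfold_locales (rule grad_differentiable[OF graph_normal[OF c open_\<Omega> order_refl normal] open_\<Omega> order_refl])
qed

lemma continuous_u: "continuous_on \<Omega> u"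
proof (rule continuous_on_open_Union[of "(\<lambda>c. \<Omega> \<inter> chart_dom c) ` M" u, THEN continuous_on_subset])
  show "open S" if "S \<in> (\<lambda>c. \<Omega> \<inter> chart_dom c) ` M" for S
    using that open_\<Omega> riemannian_chart.open_dom[OF chart] by auto
  show "continuous_on S u" if "S \<in> (\<lambda>c. \<Omega> \<inter> chart_dom c) ` M" for S
    using that chart_function.continuous_u[OF chart_function] by auto
  show "\<Omega> \<subseteq> \<Union> ((\<lambda>c. \<Omega> \<inter> chart_dom c) ` M)"
    using \<Omega>_carrier unfolding carrier_of_def by auto
qed

lemma chart_at: assumes "p \<in> \<Omega>" obtains c where "c \<in> M" "p \<in> \<Omega> \<inter> chart_dom c"
  using assms \<Omega>_carrier unfolding carrier_of_def by auto

text \<open>The defining function is \<open>u\<close> minus the height, whose derivative in the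
  vertical direction is -1.\<close>

lemma hypersurface_graph: "hypersurface (prod_line M) (graph_on \<Omega> u)"
  unfolding hypersurface_def
proof (intro conjI subsetI ballI)
  fix z assume "z \<in> graph_on \<Omega> u"
  then obtain p where p: "z = (p, u p)" "p \<in> \<Omega>" by (auto simp: graph_on_def)
  obtain c where c: "c \<in> M" "p \<in> \<Omega> \<inter> chart_dom c" using chart_at[OF p(2)] by blast
  interpret chart_function c \<Omega> u by (rule chart_function[OF c(1)])
  let ?P = "prod_line_chart c"
  have P: "?P \<in> prod_line M" using c by (simp add: prod_line_def)
  show "z \<in> carrier_of (prod_line M)"
    using P c(2) unfolding carrier_of_def p(1) by force
  let ?U = "coord c ` (\<Omega> \<inter> chart_dom c)"
  let ?V = "?U \<times> (UNIV :: real set)"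
  let ?f = "\<lambda>y. local_rep c u (fst y) + - snd y"
  have oU: "open ?U" by (rule open_coord_image[OF open_\<Omega>])
  then have V: "open ?V" by (intro open_Times) auto
  have f: "smooth_on ?V ?f"
    by (rule smooth_on_add[OF V smooth_on_compose[OF V oU _ smooth_on_bounded_linear[OF bounded_linear_fst V] smooth_u]
          smooth_on_bounded_linear[OF bounded_linear_minus[OF bounded_linear_snd] V]]) auto
  have df: "frechet_derivative ?f (at x) \<noteq> (\<lambda>v. 0)" if "x \<in> ?V" for x
  proof -
    obtain q where q: "q \<in> \<Omega> \<inter> chart_dom c" "fst x = coord c q" using \<open>x \<in> ?V\<close> by auto
    have "(?f has_derivative (\<lambda>v. du q (fst v) + - snd v)) (at x)"
      by (intro has_derivative_add has_derivative_minus has_derivative_snd has_derivative_ident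
          has_derivative_compose[OF has_derivative_fst[OF has_derivative_ident]])
        (simp add: q(2) du_has_derivative[OF q(1)])
    from frechet_derivative_at[OF this, symmetric]
    have "frechet_derivative ?f (at x) (0, 1) = - 1" by (simp add: linear_0[OF du_linear[OF q(1)]])
    then show ?thesis by (metis neg_equal_0_iff_equal zero_neq_one)
  qed
  have eq: "?V \<inter> coord ?P ` (graph_on \<Omega> u \<inter> chart_dom ?P) = {x \<in> ?V. ?f x = 0}"
    by (rule set_eqI) (simp only: Int_iff coord_graph_image mem_Collect_eq mem_Times_iff, auto)
  show "\<exists>d\<in>prod_line M. z \<in> chart_dom d \<and> (\<exists>V (f :: 'a \<times> real \<Rightarrow> real). open V \<and> coord d z \<in> V \<and>
      V \<subseteq> coord d ` chart_dom d \<and> smooth_on V f \<and> (\<forall>x\<in>V. frechet_derivative f (at x) \<noteq> (\<lambda>v. 0)) \<and>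
      V \<inter> coord d ` (graph_on \<Omega> u \<inter> chart_dom d) = {x \<in> V. f x = 0})"
    by (rule bexI[OF _ P], rule conjI, use c(2) p(1) in simp, intro exI[of _ ?V] exI[of _ ?f] conjI V f ballI df eq)
      (use c(2) p(1) in auto)
qed

lemma horizontal_section_graph: "horizontal_section (graph_on \<Omega> u) t = {p \<in> \<Omega>. u p = t}"
  by (auto simp: horizontal_section_def graph_on_def)

text \<open>The defining function is \<open>u - t\<close>; its differential pairs the gradient with
  itself to a positive number.\<close>

lemma hypersurface_level: "hypersurface M {p \<in> \<Omega>. u p = t}"
  unfolding hypersurface_def
proof (intro conjI ballI)
  show "{p \<in> \<Omega>. u p = t} \<subseteq> carrier_of M" using \<Omega>_carrier by auto
  fix p assume p: "p \<in> {p \<in> \<Omega>. u p = t}"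
  then obtain c where c: "c \<in> M" "p \<in> \<Omega> \<inter> chart_dom c" using chart_at by blast
  interpret chart_function c \<Omega> u by (rule chart_function[OF c(1)])
  let ?U = "coord c ` (\<Omega> \<inter> chart_dom c)"
  let ?f = "\<lambda>y. local_rep c u y + - t"
  have oU: "open ?U" by (rule open_coord_image[OF open_\<Omega>])
  have f: "smooth_on ?U ?f" by (rule smooth_on_add[OF oU smooth_u smooth_on_const])
  have df: "frechet_derivative ?f (at x) \<noteq> (\<lambda>v. 0)" if "x \<in> ?U" for x
  proof
    obtain q where q: "q \<in> \<Omega> \<inter> chart_dom c" "x = coord c q" using \<open>x \<in> ?U\<close> by auto
    assume 0: "frechet_derivative ?f (at x) = (\<lambda>v. 0)"
    have "(?f has_derivative (\<lambda>v. du q v + 0)) (at x)"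
      unfolding q(2) by (intro has_derivative_add has_derivative_const du_has_derivative q(1))
    from frechet_derivative_at[OF this] 0 have "du q v = 0" for v by (metis add.right_neutral)
    then have "rinner c q (grad c \<Omega> u q) (grad c \<Omega> u q) = 0" using rinner_grad[OF q(1)] by simp
    then show False using metric_pos[of q] grad_nz[OF c(1) q(1)] q(1) by (metis IntD2 less_irrefl)
  qed
  have eq: "?U \<inter> coord c ` ({p \<in> \<Omega>. u p = t} \<inter> chart_dom c) = {x \<in> ?U. ?f x = 0}"
    by (force simp: image_iff)
  show "\<exists>d\<in>M. p \<in> chart_dom d \<and> (\<exists>V (f :: 'a \<Rightarrow> real). open V \<and> coord d p \<in> V \<and>
      V \<subseteq> coord d ` chart_dom d \<and> smooth_on V f \<and> (\<forall>x\<in>V. frechet_derivative f (at x) \<noteq> (\<lambda>v. 0)) \<and>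
      V \<inter> coord d ` ({p \<in> \<Omega>. u p = t} \<inter> chart_dom d) = {x \<in> V. f x = 0})"
    by (rule bexI[OF _ c(1)], rule conjI, use c(2) in simp, intro exI[of _ ?U] exI[of _ ?f] conjI oU f ballI df eq)
      (use c(2) in auto)
qed

text \<open>Minimality gives a normal near each point, which suffices for the pointwise equation;
  conversely \<open>N\<close> serves at every point, with \<open>UNIV\<close> as
  neighbourhood.\<close>

lemma minimal_graph_iff:
  "minimal_hypersurface (prod_line M) (graph_on \<Omega> u) \<longleftrightarrow>
    (\<forall>c\<in>M. \<forall>p\<in>\<Omega> \<inter> chart_dom c.
      (1 + rinner c p (grad c \<Omega> u p) (grad c \<Omega> u p)) * laplacian c \<Omega> u p = chart_gradient.hess_grad c \<Omega> u p)"
    (is "?L \<longleftrightarrow> ?R")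
proof
  assume L: ?L
  show ?R
  proof (intro ballI)
    fix c p assume c: "c \<in> M" and p: "p \<in> \<Omega> \<inter> chart_dom c"
    interpret chart_gradient c \<Omega> u by (rule chart_gradient[OF c])
    let ?P = "prod_line_chart c"
    have P: "?P \<in> prod_line M" using c by (simp add: prod_line_def)
    have "(p, u p) \<in> graph_on \<Omega> u" using p by (auto simp: graph_on_def)
    then obtain V N' where V: "open V" "(p, u p) \<in> V" "unit_normal_field (prod_line M) (graph_on \<Omega> u \<inter> V) N'"
      "\<forall>c\<in>prod_line M. \<forall>q\<in>graph_on \<Omega> u \<inter> V \<inter> chart_dom c. mean_curvature c (graph_on \<Omega> u \<inter> V) N' q = 0"
      using L unfolding minimal_hypersurface_def by blast
    \<comment> \<open>By continuity of \<open>u\<close> the part of the graph inside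
      \<open>V\<close> is itself a graph over an open set.\<close>
    define U where "U = \<Omega> \<inter> (\<lambda>q. (q, u q)) -` V"
    have "continuous_on \<Omega> (\<lambda>q. (q, u q))"
      by (intro continuous_on_Pair continuous_on_id manifold_graph.continuous_u[OF manifold_graph_axioms])
    then have U: "open U" "U \<subseteq> \<Omega>"
      using continuous_on_open_vimage[OF open_\<Omega>, THEN iffD1] V(1)
      by (auto simp: U_def Int_commute[of \<Omega>])
    have pU: "p \<in> U \<inter> chart_dom c" using p V(2) by (auto simp: U_def)
    have S: "graph_on \<Omega> u \<inter> V = graph_on U u" by (auto simp: graph_on_def U_def)
    have "(p, u p) \<in> graph_on U u \<inter> chart_dom ?P" using pU by (auto simp: graph_on_def)
    then have "mean_curvature ?P (graph_on U u) N' (p, u p) = 0" using V(4) P unfolding S by blast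
    then show "(1 + rinner c p (grad c \<Omega> u p) (grad c \<Omega> u p)) * laplacian c \<Omega> u p = hess_grad p"
      using graph_mean_curvature_zero_iff[where N = N', OF graph_normal[OF c U V(3)[unfolded S]] U pU] by blast
  qed
next
  assume R: ?R
  have "mean_curvature d (graph_on \<Omega> u) N z = 0" if d: "d \<in> prod_line M" and z: "z \<in> graph_on \<Omega> u \<inter> chart_dom d" for d z
  proof -
    obtain c where c: "c \<in> M" "d = prod_line_chart c" using d by (auto simp: prod_line_def)
    obtain p where p: "z = (p, u p)" "p \<in> \<Omega> \<inter> chart_dom c" using z by (auto simp: graph_on_def c(2))
    interpret chart_gradient c \<Omega> u by (rule chart_gradient[OF c(1)])
    show ?thesis
      unfolding c(2) p(1)
      using graph_mean_curvature_zero_iff[where N = N, OF graph_normal[OF c(1) open_\<Omega> order_refl normal] open_\<Omega> order_refl p(2)]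
        R c(1) p(2) by blast
  qed
  then show ?L
    unfolding minimal_hypersurface_def
    by (intro conjI hypersurface_graph ballI exI[of _ UNIV] exI[of _ N]) (auto simp: normal)
qed

section \<open>Unit normals and minimality of the level sets\<close>

text \<open>At points of the level set this is \<open>n / |n|\<close> up to sign. Taking it from
  \<open>N\<close> provides a smooth local extension, whereas the gradient has been shown to be
  differentiable only.\<close>

definition level_normal :: "real \<Rightarrow> ('m, 'a) rchart \<Rightarrow> 'm \<Rightarrow> 'a" where
  "level_normal t c p = (let e = fst (N (prod_line_chart c) (p, t)) in inverse (rnorm c p e) *\<^sub>R e)"

lemma level_normal_field: "unit_normal_field M {p \<in> \<Omega>. u p = t} (level_normal t)"
proof -
  let ?S = "{p \<in> \<Omega>. u p = t}"
  have tr: "level_normal t d p = transition_deriv c d p (level_normal t c p)"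
    if cd: "c \<in> M" "d \<in> M" and p: "p \<in> ?S \<inter> chart_dom c \<inter> chart_dom d" for c d p
  proof -
    let ?P = "prod_line_chart c" and ?R = "prod_line_chart d"
    let ?e = "fst (N ?P (p, t))"
    have pcd: "p \<in> chart_dom c \<inter> chart_dom d" using p by blast
    have "?P \<in> prod_line M" "?R \<in> prod_line M" using cd by (simp_all add: prod_line_def)
    moreover have "(p, t) \<in> graph_on \<Omega> u \<inter> chart_dom ?P \<inter> chart_dom ?R" using p by (auto simp: graph_on_def)
    ultimately have "N ?R (p, t) = transition_deriv ?P ?R (p, t) (N ?P (p, t))"
      using normal unfolding unit_normal_field_def smooth_field_along_def by blast
    then have e: "fst (N ?R (p, t)) = transition_deriv c d p ?e"
      using transition_deriv_prod(2)[OF riem cd pcd chart[OF cd(1)]] by simp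
    \<comment> \<open>Transition maps are isometric, so the normalising factor is the same in both
      charts.\<close>
    have "rnorm d p (transition_deriv c d p ?e) = rnorm c p ?e"
      using riem cd pcd unfolding riemannian_manifold_def rnorm_def by auto
    then show ?thesis
      unfolding level_normal_def Let_def e
      by (simp add: linear_cmul[OF transition_deriv_prod(1)[OF riem cd pcd chart[OF cd(1)]]])
  qed
  have ch: "rnorm c p (level_normal t c p) = 1 \<and>
      (\<forall>v\<in>tangent_space c ?S p. rinner c p (level_normal t c p) v = 0) \<and>
      (\<exists>V F. open V \<and> coord c p \<in> V \<and> smooth_on V F \<and>
        (\<forall>q\<in>?S \<inter> chart_dom c. coord c q \<in> V \<longrightarrow> F (coord c q) = level_normal t c q))"
    if c: "c \<in> M" and p: "p \<in> ?S \<inter> chart_dom c" for c p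
  proof -
    interpret chart_gradient c \<Omega> u by (rule chart_gradient[OF c])
    have p\<Omega>: "p \<in> \<Omega> \<inter> chart_dom c" and pt: "u p = t" and pc: "p \<in> chart_dom c" using p by auto
    note B = metric_bilinear[OF pc]
    let ?P = "prod_line_chart c"
    let ?e = "\<lambda>q. fst (N ?P (q, t))"
    note gn = graph_normal[OF c open_\<Omega> order_refl normal]
    have e: "?e p = - snd (N ?P (p, t)) *\<^sub>R n p"
      using arg_cong[OF graph_normal_eq(1)[OF gn order_refl p\<Omega>], of fst] pt by simp
    have l0: "snd (N ?P (p, t)) \<noteq> 0"
      using graph_normal_eq(2)[OF gn order_refl p\<Omega>] pt by auto
    have "?e p \<noteq> 0" using e l0 grad_nz[OF c p\<Omega>] by simp
    then have pos: "rinner c p (?e p) (?e p) > 0" by (rule metric_pos[OF pc])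
    have "rinner c p (level_normal t c p) (level_normal t c p)
        = inverse (rnorm c p (?e p)) * inverse (rnorm c p (?e p)) * rinner c p (?e p) (?e p)"
      by (simp add: level_normal_def Let_def bilinear_lmul[OF B] bilinear_rmul[OF B])
    also have "\<dots> = 1"
      using pos by (simp add: rnorm_def inverse_eq_divide)
    finally have 1: "rnorm c p (level_normal t c p) = 1" by (simp add: rnorm_def)
    have 2: "rinner c p (level_normal t c p) v = 0" if v: "v \<in> tangent_space c ?S p" for v
    proof -
      have "du p v = 0"
        using v tangent_space_level[OF open_\<Omega> order_refl p\<Omega> pt grad_nz[OF c p\<Omega>]] by blast
      then show ?thesis
        unfolding level_normal_def Let_def e using rinner_grad[OF p\<Omega>, of v]
        by (simp add: bilinear_lmul[OF B] bilinear_lneg[OF B])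
    qed
    obtain V F where VF: "open V" "(coord c p, u p) \<in> V" "smooth_on V F"
      "\<And>q. q \<in> \<Omega> \<inter> chart_dom c \<Longrightarrow> (coord c q, u q) \<in> V \<Longrightarrow> F (coord c q, u q) = N ?P (q, u q)"
      using gn p\<Omega> unfolding graph_normal_def by metis
    \<comment> \<open>Freezing the height at \<open>t\<close> turns the extension of
      \<open>N\<close> into a function of base coordinates. \<open>V1\<close> keeps the points where
      its horizontal part has positive length, so that normalising stays smooth.\<close>
    define V0 where "V0 = (\<lambda>y. (y, t)) -` V \<inter> coord c ` chart_dom c"
    define G where "G y = fst (F (y, t))" for y
    define h where "h y = metric_tensor c y (G y) (G y)" for y
    define V1 where "V1 = h -` {0<..} \<inter> V0"
    have V0: "open V0" unfolding V0_def
      by (intro open_Int open_vimage VF(1) continuous_intros open_img)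
    have line: "smooth_on V0 (\<lambda>y. (y, t))"
      by (intro smooth_on_Pair V0 smooth_on_const smooth_on_bounded_linear bounded_linear_ident)
    have "smooth_on V0 (\<lambda>y. F (y, t))"
      by (rule smooth_on_compose[OF V0 VF(1) _ line VF(3)]) (auto simp: V0_def)
    then have G: "smooth_on V0 G"
      unfolding G_def by (rule smooth_on_linear_compose[OF bounded_linear_fst V0])
    have h: "smooth_on V0 h"
      unfolding h_def by (rule metric_field_smooth[OF V0 _ G G]) (simp add: V0_def)
    have V1: "open V1"
      unfolding V1_def
      using continuous_on_open_vimage[OF V0, THEN iffD1, OF smooth_on_continuous[OF h]] by simp
    have sub: "V1 \<subseteq> V0" by (simp add: V1_def)
    have Ge: "G (coord c q) = ?e q" if "q \<in> ?S \<inter> chart_dom c" "coord c q \<in> V0" for q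
      using VF(4)[of q] that by (simp add: G_def V0_def)
    have pV0: "coord c p \<in> V0" using VF(2) pt pc by (simp add: V0_def)
    have "coord c p \<in> V1"
      using pV0 pos Ge[OF p pV0] by (simp add: V1_def h_def rinner_def)
    moreover have "smooth_on V1 (\<lambda>y. inverse (sqrt (h y)) *\<^sub>R G y)"
      by (intro smooth_on_scaleR V1 smooth_on_inverse_sqrt smooth_on_subset[OF h sub] smooth_on_subset[OF G sub])
        (auto simp: V1_def)
    moreover have "inverse (sqrt (h (coord c q))) *\<^sub>R G (coord c q) = level_normal t c q"
      if q: "q \<in> ?S \<inter> chart_dom c" "coord c q \<in> V1" for q
    proof -
      have "coord c q \<in> V0" using q(2) sub by blast
      then have g: "G (coord c q) = ?e q" by (rule Ge[OF q(1)])
      show ?thesis unfolding h_def g level_normal_def Let_def rnorm_def rinner_def ..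
    qed
    ultimately show ?thesis using 1 2 V1 by blast
  qed
  show ?thesis
    unfolding unit_normal_field_def smooth_field_along_def
  proof (intro conjI ballI)
    fix c d p
    assume "c \<in> M" "d \<in> M" "p \<in> ?S \<inter> chart_dom c \<inter> chart_dom d"
    then show "level_normal t d p = transition_deriv c d p (level_normal t c p)" by (rule tr)
  next
    fix c p assume "c \<in> M" "p \<in> ?S \<inter> chart_dom c"
    note ch = ch[OF this]
    show "\<exists>V F. open V \<and> coord c p \<in> V \<and> smooth_on V F \<and>
        (\<forall>q\<in>?S \<inter> chart_dom c. coord c q \<in> V \<longrightarrow> F (coord c q) = level_normal t c q)"
      using ch by (elim conjE)
    show "rnorm c p (level_normal t c p) = 1" using ch by (elim conjE)
    show "rinner c p (level_normal t c p) v = 0" if "v \<in> tangent_space c ?S p" for v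
      using ch that by (elim conjE) (erule bspec)
  qed
qed

lemma level_mean_curvature_iff:
  assumes c: "c \<in> M" and p: "p \<in> \<Omega> \<inter> chart_dom c" and V: "open V" "p \<in> V"
    and N: "unit_normal_field M ({q \<in> \<Omega>. u q = u p} \<inter> V) N'"
  shows "mean_curvature c ({q \<in> \<Omega>. u q = u p} \<inter> V) N' p = 0 \<longleftrightarrow>
    rinner c p (grad c \<Omega> u p) (grad c \<Omega> u p) * laplacian c \<Omega> u p = chart_gradient.hess_grad c \<Omega> u p"
proof -
  interpret chart_gradient c \<Omega> u by (rule chart_gradient[OF c])
  let ?U = "\<Omega> \<inter> V"
  have U: "open ?U" "?U \<subseteq> \<Omega>" using open_\<Omega> V by auto
  have pU: "p \<in> ?U \<inter> chart_dom c" using p V by auto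
  have S: "{q \<in> \<Omega>. u q = u p} \<inter> V = {q \<in> ?U. u q = u p}" by blast
  note N' = N[unfolded S unit_normal_field_def smooth_field_along_def]
  have nz: "n q \<noteq> 0" if "q \<in> ?U \<inter> chart_dom c" for q using grad_nz[OF c] that by blast
  have unit: "rinner c q (N' c q) (N' c q) = 1" if "q \<in> ?U \<inter> chart_dom c" "u q = u p" for q
  proof -
    have "rnorm c q (N' c q) = 1" using N' c that by blast
    then show ?thesis by (simp add: rnorm_def)
  qed
  have norm: "rinner c q (N' c q) v = 0" if q: "q \<in> ?U \<inter> chart_dom c" "u q = u p" "du q v = 0" for q v
  proof -
    have "v \<in> tangent_space c {q \<in> ?U. u q = u p} q"
      using tangent_space_level[OF U q(1,2) nz[OF q(1)]] q(3) by blast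
    then show ?thesis using N' c q by blast
  qed
  have "\<exists>X F. open X \<and> coord c p \<in> X \<and> smooth_on X F \<and>
        (\<forall>q\<in>{q \<in> ?U. u q = u p} \<inter> chart_dom c. coord c q \<in> X \<longrightarrow> F (coord c q) = N' c q)"
    using N' c pU by blast
  then obtain X F where X: "open X" "coord c p \<in> X" "smooth_on X F"
    "\<And>q. q \<in> {q \<in> ?U. u q = u p} \<inter> chart_dom c \<Longrightarrow> coord c q \<in> X \<Longrightarrow> F (coord c q) = N' c q" by blast
  show ?thesis
    unfolding S
    by (rule level_mean_curvature_zero_iff[where N = N', OF U pU refl nz unit norm X(1-3)]) (use X(4) in auto)
qed

text \<open>Each \<open>p\<close> lies in exactly one section, that of height \<open>u p\<close>, so
  quantifying over \<open>t\<close> yields the equation on all of \<open>\<Omega>\<close>.\<close>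

lemma minimal_sections_iff:
  "(\<forall>t. minimal_hypersurface M (horizontal_section (graph_on \<Omega> u) t)) \<longleftrightarrow>
    (\<forall>c\<in>M. \<forall>p\<in>\<Omega> \<inter> chart_dom c.
      rinner c p (grad c \<Omega> u p) (grad c \<Omega> u p) * laplacian c \<Omega> u p = chart_gradient.hess_grad c \<Omega> u p)"
    (is "?L \<longleftrightarrow> ?R")
  unfolding horizontal_section_graph
proof
  assume L: "\<forall>t. minimal_hypersurface M {p \<in> \<Omega>. u p = t}"
  show ?R
  proof (intro ballI)
    fix c p assume c: "c \<in> M" and p: "p \<in> \<Omega> \<inter> chart_dom c"
    let ?S = "{q \<in> \<Omega>. u q = u p}"
    have "p \<in> ?S" using p by blast
    then obtain V N' where V: "open V" "p \<in> V" "unit_normal_field M (?S \<inter> V) N'"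
      "\<forall>c\<in>M. \<forall>q\<in>?S \<inter> V \<inter> chart_dom c. mean_curvature c (?S \<inter> V) N' q = 0"
      using L[rule_format, of "u p"] unfolding minimal_hypersurface_def by blast
    then have "mean_curvature c (?S \<inter> V) N' p = 0" using c p by blast
    then show "rinner c p (grad c \<Omega> u p) (grad c \<Omega> u p) * laplacian c \<Omega> u p = chart_gradient.hess_grad c \<Omega> u p"
      using level_mean_curvature_iff[OF c p V(1-3)] by blast
  qed
next
  assume R: ?R
  show "\<forall>t. minimal_hypersurface M {p \<in> \<Omega>. u p = t}"
  proof
    fix t
    have "mean_curvature c {p \<in> \<Omega>. u p = t} (level_normal t) q = 0"
      if c: "c \<in> M" and q: "q \<in> {p \<in> \<Omega>. u p = t} \<inter> chart_dom c" for c q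
    proof -
      have q\<Omega>: "q \<in> \<Omega> \<inter> chart_dom c" and t: "t = u q" using q by auto
      show ?thesis
        using level_mean_curvature_iff[OF c q\<Omega> open_UNIV UNIV_I, of "level_normal t"] level_normal_field[of t] R c q\<Omega>
        unfolding t by simp
    qed
    then show "minimal_hypersurface M {p \<in> \<Omega>. u p = t}"
      unfolding minimal_hypersurface_def
      by (intro conjI hypersurface_level ballI exI[of _ UNIV] exI[of _ "level_normal t"])
        (auto simp: level_normal_field)
  qed
qed

lemma asymptotic_iff:
  "(\<forall>c\<in>prod_line M. \<forall>p\<in>graph_on \<Omega> u \<inter> chart_dom c.
      rinner c p (shape_operator c (graph_on \<Omega> u) N p (height_grad c (graph_on \<Omega> u) p))
        (height_grad c (graph_on \<Omega> u) p) = 0) \<longleftrightarrow>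
    (\<forall>c\<in>M. \<forall>p\<in>\<Omega> \<inter> chart_dom c. chart_gradient.hess_grad c \<Omega> u p = 0)" (is "?L \<longleftrightarrow> ?R")
proof -
  have "rinner (prod_line_chart c) (p, u p)
      (shape_operator (prod_line_chart c) (graph_on \<Omega> u) N (p, u p) (height_grad (prod_line_chart c) (graph_on \<Omega> u) (p, u p)))
      (height_grad (prod_line_chart c) (graph_on \<Omega> u) (p, u p)) = 0 \<longleftrightarrow> chart_gradient.hess_grad c \<Omega> u p = 0"
    if c: "c \<in> M" and p: "p \<in> \<Omega> \<inter> chart_dom c" for c p
    by (rule chart_gradient.graph_asymptotic_iff[where N = N, OF chart_gradient[OF c]
        graph_normal[OF c open_\<Omega> order_refl normal] open_\<Omega> order_refl p])
  then show ?thesis by (fastforce simp: prod_line_def graph_on_def)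
qed

text \<open>The horizontal component of the height gradient is a positive multiple of the gradient
  of \<open>u\<close>.\<close>

lemma no_horizontal_points: "\<not> horizontal_point M (graph_on \<Omega> u) z"
proof
  assume "horizontal_point M (graph_on \<Omega> u) z"
  then obtain c p where c: "c \<in> M" and z: "z = (p, u p)" and p: "p \<in> \<Omega> \<inter> chart_dom c"
    and h: "height_grad (prod_line_chart c) (graph_on \<Omega> u) z = 0"
    by (auto simp: horizontal_point_def graph_on_def prod_line_def)
  interpret chart_gradient c \<Omega> u by (rule chart_gradient[OF c])
  have "1 + rinner c p (n p) (n p) > 0" using norm_grad_nonneg[OF p] by simp
  then show False
    using h grad_nz[OF c p] unfolding z height_grad_graph[OF open_\<Omega> order_refl p] by (simp add: zero_prod_def)
qed

lemma homothetic_iff: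
  "horizontally_homothetic_on M \<Omega> u \<longleftrightarrow> (\<forall>c\<in>M. \<forall>p\<in>\<Omega> \<inter> chart_dom c. chart_gradient.hess_grad c \<Omega> u p = 0)"
  unfolding horizontally_homothetic_on_def
  using chart_gradient.horizontally_homothetic_at_iff[OF chart_gradient _ grad_nz] by blast

lemma grad_norm_pos:
  "c \<in> M \<Longrightarrow> p \<in> \<Omega> \<inter> chart_dom c \<Longrightarrow> rinner c p (grad c \<Omega> u p) (grad c \<Omega> u p) > 0"
  using riemannian_chart.metric_pos[OF chart] grad_nz by blast

end

theorem theorem2:
  fixes M :: "('m::{t2_space,second_countable_topology}, 'a::euclidean_space) rchart set"
    and \<Omega> :: "'m set"
    and u :: "'m \<Rightarrow> real"
    and N :: "('m \<times> real, 'a \<times> real) rchart \<Rightarrow> 'm \<times> real \<Rightarrow> 'a \<times> real"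
  defines "\<Sigma> \<equiv> graph_on \<Omega> u"
  assumes "riemannian_manifold M" and "DIM('a) \<ge> 2"
    and "open \<Omega>" and "connected \<Omega>" and "\<Omega> \<subseteq> carrier_of M"
    and "smooth_fun_on M \<Omega> u"
    and "\<forall>c\<in>M. \<forall>p\<in>\<Omega> \<inter> chart_dom c. grad c \<Omega> u p \<noteq> 0"
    and "unit_normal_field (prod_line M) \<Sigma> N"
    and "nonconstant_angle M \<Sigma> N"
  shows "(vertical_helicoid M \<Sigma> N \<longleftrightarrow> harmonic_on M \<Omega> u \<and> minimal_hypersurface (prod_line M) \<Sigma>) \<and>
         (harmonic_on M \<Omega> u \<and> minimal_hypersurface (prod_line M) \<Sigma> \<longleftrightarrow>
          harmonic_on M \<Omega> u \<and> horizontally_homothetic_on M \<Omega> u)"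
proof -
  interpret manifold_graph M \<Omega> u N
    using assms unfolding \<Sigma>_def by unfold_locales auto
  let ?Q = "\<lambda>c p. chart_gradient.hess_grad c \<Omega> u p" and ?n = "\<lambda>c p. grad c \<Omega> u p"
  let ?all = "\<lambda>P. \<forall>c\<in>M. \<forall>p\<in>\<Omega> \<inter> chart_dom c. P c p"
  have "vertical_helicoid M \<Sigma> N \<longleftrightarrow>
      ?all (\<lambda>c p. rinner c p (?n c p) (?n c p) * laplacian c \<Omega> u p = ?Q c p) \<and> ?all (\<lambda>c p. ?Q c p = 0)"
    unfolding vertical_helicoid_def \<Sigma>_def minimal_sections_iff asymptotic_iff
    using hypersurface_graph normal no_horizontal_points \<open>nonconstant_angle M \<Sigma> N\<close>[unfolded \<Sigma>_def] by blast
  also have "\<dots> \<longleftrightarrow> ?all (\<lambda>c p. laplacian c \<Omega> u p = 0) \<and> ?all (\<lambda>c p. ?Q c p = 0)"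
  proof -
    \<comment> \<open>Once \<open>Q\<close> vanishes, the section equation says
      \<open>|n|^2 L = 0\<close>, and \<open>|n|^2\<close> is positive.\<close>
    have "rinner c p (?n c p) (?n c p) * laplacian c \<Omega> u p = ?Q c p \<and> ?Q c p = 0
        \<longleftrightarrow> laplacian c \<Omega> u p = 0 \<and> ?Q c p = 0"
      if "c \<in> M" "p \<in> \<Omega> \<inter> chart_dom c" for c p
      using grad_norm_pos[OF that] by auto
    then show ?thesis by blast
  qed
  finally have "vertical_helicoid M \<Sigma> N \<longleftrightarrow> harmonic_on M \<Omega> u \<and> horizontally_homothetic_on M \<Omega> u"
    unfolding harmonic_on_def homothetic_iff .
  \<comment> \<open>For \<open>L = 0\<close> the minimality equation of the graph reduces to
    \<open>Q = 0\<close>.\<close>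
  moreover have "harmonic_on M \<Omega> u \<and> minimal_hypersurface (prod_line M) \<Sigma> \<longleftrightarrow>
      harmonic_on M \<Omega> u \<and> horizontally_homothetic_on M \<Omega> u"
    unfolding harmonic_on_def homothetic_iff \<Sigma>_def minimal_graph_iff by auto
  ultimately show ?thesis by blast
qed

end
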